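(* Let $0\le V\in L^1_{loc}(\Omega)$ and $f\in L^1(\Omega,\delta^s)$. If $u\in L^1(\Omega)$ is a very weak local solution of $(-\Delta)^s u+Vu=f$ in $\Omega$, $u=0$ outside $\Omega$, and in addition $Vu\delta^s\in L^1(\Omega)$ and $u/\delta^s\in L^1(\Omega)$, then $u$ is a very weak solution of that problem.
   Context: Setting: $n\ge 2$, $s\in(0,1)$, $\Omega\subset\mathbb R^n$ bounded domain with $C^2$ boundary, $\delta(x)=\operatorname{dist}(x,\mathbb R^n\setminus\Omega)$, $(-\Delta)^s u(x) = c_{n,s}\,\mathrm{P.V.}\int_{\mathbb R^n}\frac{u(x)-u(y)}{|x-y|^{n+2s}}\,dy$. $L^1(\Omega,\delta^s)=\{f: f\delta^s\in L^1(\Omega)\}$. $X^s=\{\varphi\in C^s(\mathbb R^n): \varphi=0 \text{ in }\mathbb R^n\setminus\Omega,\ (-\Delta)^s\varphi\in L^\infty(\Omega)\}$. Very weak local solution: $u\in L^1(\Omega)$, $u=0$ a.e. in $\mathbb R^n\setminus\Omega$, $Vu\in L^1_{loc}(\Omega)$, and $\int_\Omega u[(-\Delta)^s\varphi+V\varphi]=\int_\Omega f\varphi$ for all $\varphi\in X^s\cap C_c(\Omega)$. Very weak solution: $u\in L^1(\Omega)$, $u=0$ a.e. outside $\Omega$, $Vu\delta^s\in L^1(\Omega)$, and $\int_\Omega u(-\Delta)^s\varphi+\int_\Omega Vu\varphi=\int_\Omega f\varphi$ for all $\varphi\in X^s$. *)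

theory Defs
  imports "HOL-Analysis.Analysis"
begin

definition dimn :: "'n::finite itself \<Rightarrow> real" where
  "dimn _ = real CARD('n)"

definition frac_const :: "'n::finite itself \<Rightarrow> real \<Rightarrow> real" where
  "frac_const T s = 4 powr s * Gamma (dimn T / 2 + s) / (pi powr (dimn T / 2) * \<bar>Gamma (- s)\<bar>)"

definition frac_trunc :: "real \<Rightarrow> (real^'n::finite \<Rightarrow> real) \<Rightarrow> real^'n \<Rightarrow> real \<Rightarrow> real" where
  "frac_trunc s u x \<epsilon> =
     (LINT y : {y. dist x y > \<epsilon>} | lebesgue.
        (u x - u y) / norm (x - y) powr (real CARD('n) + 2 * s))"

definition frac_lap_exists :: "real \<Rightarrow> (real^'n::finite \<Rightarrow> real) \<Rightarrow> real^'n \<Rightarrow> bool" where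
  "frac_lap_exists s u x \<longleftrightarrow>
     (\<forall>\<epsilon>>0. set_integrable lebesgue {y. dist x y > \<epsilon>}
                (\<lambda>y. (u x - u y) / norm (x - y) powr (real CARD('n) + 2 * s)))
   \<and> (\<exists>L. (frac_trunc s u x \<longlongrightarrow> L) (at_right 0))"

definition frac_lap :: "real \<Rightarrow> (real^'n::finite \<Rightarrow> real) \<Rightarrow> real^'n \<Rightarrow> real" where
  "frac_lap s u x = frac_const TYPE('n) s * Lim (at_right 0) (frac_trunc s u x)"

definition bdist :: "(real^'n::finite) set \<Rightarrow> real^'n \<Rightarrow> real" where
  "bdist \<Omega> x = infdist x (- \<Omega>)"

definition C2_bounded_domain :: "(real^'n::finite) set \<Rightarrow> bool" where
  "C2_bounded_domain \<Omega> \<longleftrightarrow> open \<Omega> \<and> connected \<Omega> \<and> bounded \<Omega> \<and> \<Omega> \<noteq> {} \<and>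
     (\<forall>x0\<in>frontier \<Omega>. \<exists>r>0. \<exists>\<rho> :: real^'n \<Rightarrow> real. \<exists>D :: real^'n \<Rightarrow> real^'n.
        \<exists>D2 :: real^'n \<Rightarrow> ((real^'n) \<Rightarrow>\<^sub>L (real^'n)).
          (\<forall>x\<in>ball x0 r. (\<rho> has_derivative (\<lambda>h. D x \<bullet> h)) (at x)) \<and>
          (\<forall>x\<in>ball x0 r. (D has_derivative blinfun_apply (D2 x)) (at x)) \<and>
          continuous_on (ball x0 r) D2 \<and>
          (\<forall>x\<in>ball x0 r. D x \<noteq> 0) \<and>
          \<Omega> \<inter> ball x0 r = {x\<in>ball x0 r. \<rho> x < 0})"

definition holder_space :: "real \<Rightarrow> (real^'n::finite \<Rightarrow> real) set" where
  "holder_space s = {\<phi>. bounded (range \<phi>) \<and>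
     (\<exists>C. \<forall>x y. \<bar>\<phi> x - \<phi> y\<bar> \<le> C * dist x y powr s)}"

definition Xs :: "real \<Rightarrow> (real^'n::finite) set \<Rightarrow> (real^'n \<Rightarrow> real) set" where
  "Xs s \<Omega> = {\<phi>. \<phi> \<in> holder_space s \<and> (\<forall>x. x \<notin> \<Omega> \<longrightarrow> \<phi> x = 0) \<and>
      (\<forall>x\<in>\<Omega>. frac_lap_exists s \<phi> x) \<and>
      set_borel_measurable lebesgue \<Omega> (frac_lap s \<phi>) \<and>
      (\<exists>M. AE x in lebesgue. x \<in> \<Omega> \<longrightarrow> \<bar>frac_lap s \<phi> x\<bar> \<le> M)}"

definition Cc :: "(real^'n::finite) set \<Rightarrow> (real^'n \<Rightarrow> real) set" where
  "Cc \<Omega> = {\<phi>. continuous_on UNIV \<phi> \<and>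
      (\<exists>K. compact K \<and> K \<subseteq> \<Omega> \<and> (\<forall>x. x \<notin> K \<longrightarrow> \<phi> x = 0))}"

definition L1 :: "(real^'n::finite) set \<Rightarrow> (real^'n \<Rightarrow> real) \<Rightarrow> bool" where
  "L1 \<Omega> g \<longleftrightarrow> set_integrable lebesgue \<Omega> g"

definition L1_loc :: "(real^'n::finite) set \<Rightarrow> (real^'n \<Rightarrow> real) \<Rightarrow> bool" where
  "L1_loc \<Omega> g \<longleftrightarrow> (\<forall>K. compact K \<and> K \<subseteq> \<Omega> \<longrightarrow> set_integrable lebesgue K g)"

definition very_weak_local_sol ::
  "real \<Rightarrow> (real^'n::finite) set \<Rightarrow> (real^'n \<Rightarrow> real) \<Rightarrow> (real^'n \<Rightarrow> real) \<Rightarrow> (real^'n \<Rightarrow> real) \<Rightarrow> bool" where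
  "very_weak_local_sol s \<Omega> V f u \<longleftrightarrow>
     L1 \<Omega> u \<and> (AE x in lebesgue. x \<notin> \<Omega> \<longrightarrow> u x = 0) \<and>
     L1_loc \<Omega> (\<lambda>x. V x * u x) \<and>
     (\<forall>\<phi>\<in>Xs s \<Omega> \<inter> Cc \<Omega>.
        (LINT x : \<Omega> | lebesgue. u x * (frac_lap s \<phi> x + V x * \<phi> x))
        = (LINT x : \<Omega> | lebesgue. f x * \<phi> x))"

definition very_weak_sol ::
  "real \<Rightarrow> (real^'n::finite) set \<Rightarrow> (real^'n \<Rightarrow> real) \<Rightarrow> (real^'n \<Rightarrow> real) \<Rightarrow> (real^'n \<Rightarrow> real) \<Rightarrow> bool" where
  "very_weak_sol s \<Omega> V f u \<longleftrightarrow>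
     L1 \<Omega> u \<and> (AE x in lebesgue. x \<notin> \<Omega> \<longrightarrow> u x = 0) \<and>
     L1 \<Omega> (\<lambda>x. V x * u x * bdist \<Omega> x powr s) \<and>
     (\<forall>\<phi>\<in>Xs s \<Omega>.
        (LINT x : \<Omega> | lebesgue. u x * frac_lap s \<phi> x)
        + (LINT x : \<Omega> | lebesgue. V x * u x * \<phi> x)
        = (LINT x : \<Omega> | lebesgue. f x * \<phi> x))"

end

theory Submission
  imports Defs
begin

text \<open>
  A test function \<open>\<phi>\<close> in \<open>X\<^sup>s\<close> is replaced by \<open>\<phi> \<eta>\<close>, where the cutoff \<open>\<eta>\<close> vanishes where
  \<open>\<delta> < e\<close> and equals 1 where \<open>\<delta> \<ge> 3e\<close>. Hoelder continuity of \<open>\<phi>\<close> gives \<open>\<bar>\<phi>\<bar> \<le> H \<delta>\<^sup>s\<close>.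
  Where \<open>\<delta> < 6e\<close>, the product rule bounds \<open>(-\<Delta>)\<^sup>s(\<phi> \<eta>) - \<eta> (-\<Delta>)\<^sup>s \<phi>\<close> by a multiple of
  \<open>\<bar>\<phi>\<bar> e\<^bsup>-2s\<^esup> + H e\<^bsup>-s\<^esup>\<close>, hence of \<open>\<delta>\<^bsup>-s\<^esup>\<close>. Where \<open>\<delta> \<ge> 6e\<close>, the functions \<open>\<phi> \<eta>\<close> and \<open>\<phi>\<close>
  agree near the point and differ elsewhere by \<open>O(e\<^sup>s)\<close>, so \<open>(-\<Delta>)\<^sup>s(\<phi> \<eta>) - (-\<Delta>)\<^sup>s \<phi>\<close> is
  \<open>O(e\<^sup>s \<delta>\<^bsup>-2s\<^esup>)\<close>: again at most a multiple of \<open>\<delta>\<^bsup>-s\<^esup>\<close>, and it tends to 0. Since \<open>u / \<delta>\<^sup>s\<close> is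
  integrable, dominated convergence passes to the limit \<open>e \<rightarrow> 0\<close>. The cutoffs are mollified
  indicators of \<open>{\<delta> \<ge> 2e}\<close>.
\<close>

section \<open>The singular kernel\<close>

text \<open>A model for the integrands below at scale \<open>e\<close>: \<open>b\<close> is the
  order of the singularity beyond the dimension, \<open>m\<close> the order to which the numerator
  vanishes at \<open>x\<close>, capped beyond distance \<open>e\<close>. It is used with (m, b) =
  (1, s) for a product of two first differences and (2, 2s) for a second difference. At
  \<open>y = x\<close> it is 0, because \<open>0 powr a = 0\<close>.\<close>

definition sing_kernel :: "real \<Rightarrow> real \<Rightarrow> real \<Rightarrow> 'a::euclidean_space \<Rightarrow> 'a \<Rightarrow> real" where
  "sing_kernel m b e x y = min 1 ((dist x y / e) powr m) * dist x y powr (- b - real DIM('a))"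

lemma sing_kernel_nonneg: "0 \<le> sing_kernel m b e x y"
  by (simp add: sing_kernel_def)

lemma borel_measurable_sing_kernel [measurable]: "sing_kernel m b e x \<in> borel_measurable borel"
  unfolding sing_kernel_def by measurable

text \<open>Split by the sign of the floor of log2 t. Natural indices in both cases make each family
  summable as an ordinary geometric series.\<close>

lemma dyadic_annulus_cases:
  fixes t :: real
  assumes "0 < t"
  obtains (far) k :: nat where "2 powr real k \<le> t" "t \<le> 2 powr (real k + 1)"
    | (near) k :: nat where "2 powr (- real k - 1) \<le> t" "t \<le> 2 powr (- real k)"
proof -
  define j where "j = \<lfloor>log 2 t\<rfloor>"
  have t: "2 powr (log 2 t) = t" using assms by simp
  have l: "2 powr real_of_int j \<le> t"
    by (metis t j_def of_int_floor_le powr_mono one_le_numeral)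
  have u: "t \<le> 2 powr (real_of_int j + 1)"
    by (metis t j_def real_of_int_floor_add_one_ge powr_mono one_le_numeral)
  show ?thesis
  proof (cases "j \<ge> 0")
    case True
    then show ?thesis using far[of "nat j"] l u by simp
  next
    case False
    then have "- real (nat (- j - 1)) = real_of_int j + 1" by simp
    then show ?thesis using near[of "nat (- j - 1)"] l u by (simp add: add.commute)
  qed
qed

text \<open>Decompose into dyadic annuli about \<open>x\<close>. Up to constants the k-th inner
  annulus contributes e^(-b) 2^((b-m)k) and the k-th outer one e^(-b) 2^(-bk); \<open>b < m\<close>
  sums the former, \<open>0 < b\<close> the latter. The constant depends on neither \<open>e\<close>
  nor \<open>x\<close>.\<close>

lemma sing_kernel_integral_bound:
  assumes b: "0 < b" "b < m"
  obtains C where "0 \<le> C"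
    "\<And>e (x::'a::euclidean_space). 0 < e \<Longrightarrow> integrable lborel (sing_kernel m b e x)"
    "\<And>e (x::'a). 0 < e \<Longrightarrow> (\<integral>y. sing_kernel m b e x y \<partial>lborel) \<le> C * e powr (- b)"
proof -
  define N where "N = real DIM('a)"
  define w where "w = unit_ball_vol N"
  have w: "0 \<le> w" by (simp add: w_def N_def)
  define P1 where "P1 = w * 2 powr (b + N)"
  define P2 where "P2 = w * 2 powr N"
  define q1 where "q1 = (2::real) powr (b - m)"
  define q2 where "q2 = (2::real) powr (- b)"
  define C where "C = P1 * (1 / (1 - q1)) + P2 * (1 / (1 - q2))"
  have q: "0 < q1" "q1 < 1" "0 < q2" "q2 < 1"
    using b by (auto simp: q1_def q2_def powr_less_one)
  have P: "0 \<le> P1" "0 \<le> P2" using w by (auto simp: P1_def P2_def)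
  have C0: "0 \<le> C" unfolding C_def using q P by (intro add_nonneg_nonneg mult_nonneg_nonneg) auto
  have main: "(\<integral>\<^sup>+y. ennreal (sing_kernel m b e x y) \<partial>lborel) \<le> ennreal (C * e powr (- b))"
    if e: "0 < e" for e and x :: 'a
  proof -
    \<comment> \<open>\<open>c k\<close> and \<open>d k\<close> bound the kernel on the k-th inner
      and outer annulus. In \<open>F\<close> the annuli are enlarged to balls, which changes the
      volumes only by a constant factor and keeps both series geometric.\<close>
    define c where "c k = 2 powr (- (m * real k)) * (2 powr (- real k - 1) * e) powr (- b - N)" for k :: nat
    define d where "d k = (2 powr real k * e) powr (- b - N)" for k :: nat
    define F where "F k y = ennreal (c k) * indicator (cball x (2 powr (- real k) * e)) y
       + ennreal (d k) * indicator (cball x (2 powr (real k + 1) * e)) y" for k y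
    have [measurable]: "cball x r \<in> sets borel" for r by simp
    have pw: "\<exists>k. ennreal (sing_kernel m b e x y) \<le> F k y" for y
    proof (cases "x = y")
      case True then show ?thesis by (simp add: sing_kernel_def)
    next
      case False
      define t where "t = dist x y"
      have t: "0 < t" using False by (simp add: t_def)
      have "0 < t / e" using t e by simp
      then show ?thesis
      proof (cases rule: dyadic_annulus_cases)
        case (far k)
        have "sing_kernel m b e x y \<le> 1 * t powr (- b - N)"
          unfolding sing_kernel_def t_def N_def by (intro mult_right_mono) auto
        also have "1 * t powr (- b - N) \<le> d k"
          unfolding d_def using far e b
          by (auto simp: N_def field_simps intro!: powr_mono2')
        finally have "ennreal (sing_kernel m b e x y) \<le> ennreal (d k)" by (simp add: ennreal_leI)
        moreover have "y \<in> cball x (2 powr (real k + 1) * e)"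
          using far e by (simp add: t_def[symmetric] field_simps)
        ultimately show ?thesis by (intro exI[of _ k]) (simp add: F_def add_increasing)
      next
        case (near k)
        have "(t / e) powr m \<le> (2 powr (- real k)) powr m"
          using near t e b by (intro powr_mono2) auto
        then have 1: "min 1 ((t / e) powr m) \<le> 2 powr (- (m * real k))"
          by (simp add: powr_powr mult.commute)
        have 2: "t powr (- b - N) \<le> (2 powr (- real k - 1) * e) powr (- b - N)"
          using near e b by (auto simp: N_def field_simps intro!: powr_mono2')
        have "sing_kernel m b e x y \<le> c k"
          unfolding sing_kernel_def c_def t_def[symmetric] N_def[symmetric]
          by (intro mult_mono 1 2) auto
        then have "ennreal (sing_kernel m b e x y) \<le> ennreal (c k)" by (simp add: ennreal_leI)
        moreover have "y \<in> cball x (2 powr (- real k) * e)"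
          using near e by (simp add: t_def[symmetric] field_simps)
        ultimately show ?thesis by (intro exI[of _ k]) (simp add: F_def add_increasing2)
      qed
    qed
    have pw': "ennreal (sing_kernel m b e x y) \<le> (\<Sum>k. F k y)" for y
    proof -
      obtain k where "ennreal (sing_kernel m b e x y) \<le> F k y" using pw by blast
      also have "F k y \<le> (\<Sum>k. F k y)"
        using sum_le_suminf[of "\<lambda>k. F k y" "{k}"] by simp
      finally show ?thesis .
    qed
    have c: "c k * (w * (2 powr (- real k) * e) ^ DIM('a)) = e powr (- b) * P1 * q1 ^ k" for k
    proof -
      have "(2 powr (- real k) * e) ^ DIM('a) = (2 powr (- real k) * e) powr N"
        using e by (simp add: N_def powr_realpow)
      moreover have "q1 ^ k = 2 powr ((b - m) * real k)"
        by (simp add: q1_def powr_powr flip: powr_realpow)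
      ultimately show ?thesis using e
        by (simp add: c_def P1_def powr_mult powr_powr powr_minus[symmetric] powr_diff powr_add algebra_simps powr_divide)
           (simp add: field_simps powr_add[symmetric] powr_diff[symmetric] powr_minus)
    qed
    have d: "d k * (w * (2 powr (real k + 1) * e) ^ DIM('a)) = e powr (- b) * P2 * q2 ^ k" for k
    proof -
      have "(2 powr (real k + 1) * e) ^ DIM('a) = (2 powr (real k + 1) * e) powr N"
        using e by (simp add: N_def powr_realpow)
      moreover have "q2 ^ k = 2 powr (- b * real k)"
        by (simp add: q2_def powr_powr flip: powr_realpow)
      ultimately show ?thesis using e
        by (simp add: d_def P2_def powr_mult powr_powr powr_diff powr_add algebra_simps)
    qed
    have cd: "0 \<le> c k" "0 \<le> d k" for k by (auto simp: c_def d_def)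
    have intF: "(\<integral>\<^sup>+y. F k y \<partial>lborel) = ennreal (e powr (- b) * P1 * q1 ^ k + e powr (- b) * P2 * q2 ^ k)" for k
    proof -
      have "(\<integral>\<^sup>+y. F k y \<partial>lborel) = ennreal (c k) * emeasure lborel (cball x (2 powr (- real k) * e))
         + ennreal (d k) * emeasure lborel (cball x (2 powr (real k + 1) * e))"
        unfolding F_def by (subst nn_integral_add) (simp_all add: nn_integral_cmult_indicator)
      also have "\<dots> = ennreal (c k * (w * (2 powr (- real k) * e) ^ DIM('a)) + d k * (w * (2 powr (real k + 1) * e) ^ DIM('a)))"
        using e cd w by (simp add: emeasure_cball ennreal_mult' [symmetric] w_def N_def)
      finally show ?thesis by (simp add: c d)
    qed
    have "(\<integral>\<^sup>+y. ennreal (sing_kernel m b e x y) \<partial>lborel) \<le> (\<integral>\<^sup>+y. (\<Sum>k. F k y) \<partial>lborel)"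
      by (intro nn_integral_mono pw')
    also have "\<dots> = (\<Sum>k. \<integral>\<^sup>+y. F k y \<partial>lborel)"
      by (intro nn_integral_suminf) (simp add: F_def)
    also have "\<dots> = ennreal (e powr (- b) * P1 * (1 / (1 - q1)) + e powr (- b) * P2 * (1 / (1 - q2)))"
      unfolding intF
      by (intro suminf_ennreal_eq sums_add sums_mult geometric_sums) (use q P in auto)
    also have "\<dots> = ennreal (C * e powr (- b))" by (simp add: C_def algebra_simps)
    finally show ?thesis .
  qed
  show ?thesis
  proof (rule that[OF C0])
    fix e :: real and x :: 'a assume e: "0 < e"
    show "integrable lborel (sing_kernel m b e x)"
      using order.strict_trans1[OF main[OF e, of x] ennreal_less_top]
      by (intro integrableI_nonneg) (auto simp: sing_kernel_nonneg)
    show "(\<integral>y. sing_kernel m b e x y \<partial>lborel) \<le> C * e powr (- b)"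
      using main[OF e, of x] C0
      by (subst integral_eq_nn_integral) (auto simp: sing_kernel_nonneg intro!: enn2real_leI)
  qed
qed

section \<open>Smooth cutoff functions\<close>

lemma lborel_distr_reflect:
  fixes a :: "'a::euclidean_space"
  shows "distr lborel borel (\<lambda>y. a - y) = lborel"
  using lborel_affine[of "-1" a] by (simp add: density_1)

lemma
  fixes a :: "'a::euclidean_space" and g :: "'a \<Rightarrow> real"
  assumes [measurable]: "g \<in> borel_measurable borel"
  shows lborel_integral_reflect: "(\<integral>y. g (a - y) \<partial>lborel) = (\<integral>y. g y \<partial>lborel)"
    and lborel_integrable_reflect: "integrable lborel (\<lambda>y. g (a - y)) \<longleftrightarrow> integrable lborel g"
proof -
  have "(\<integral>y. g (a - y) \<partial>lborel) = (\<integral>y. g y \<partial>distr lborel borel (\<lambda>y. a - y))"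
    by (rule integral_distr[symmetric]) auto
  then show "(\<integral>y. g (a - y) \<partial>lborel) = (\<integral>y. g y \<partial>lborel)"
    by (simp add: lborel_distr_reflect)
  have "integrable (distr lborel borel (\<lambda>y. a - y)) g \<longleftrightarrow> integrable lborel (\<lambda>y. g (a - y))"
    by (rule integrable_distr_eq) auto
  then show "integrable lborel (\<lambda>y. g (a - y)) \<longleftrightarrow> integrable lborel g"
    by (simp add: lborel_distr_reflect)
qed

text \<open>Squaring the positive part of a quadratic gives a C^{1,1} profile supported in the unit
  ball. Its second differences are quadratic in the step, which is enough regularity for an operator
  of order 2s < 2, and its bounds stay elementary.\<close>

definition bump :: "'a::euclidean_space \<Rightarrow> real" where
  "bump v = (max 0 (1 - (norm v)\<^sup>2))\<^sup>2"

lemma bump_nonneg: "0 \<le> bump v"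
  by (simp add: bump_def)

lemma bump_le_1: "bump v \<le> 1"
  by (auto simp: bump_def max_def intro!: power_le_one)

lemma bump_eq_0: "1 \<le> norm v \<Longrightarrow> bump v = 0"
  using one_le_power[of "norm v" 2] by (simp add: bump_def)

lemma borel_measurable_bump [measurable]: "bump \<in> borel_measurable borel"
  unfolding bump_def by measurable

text \<open>The derivative \<open>2 * max 0 a\<close> of the squared positive part is Lipschitz with
  constant 2, whence the quadratic Taylor remainder; the sign patterns of \<open>a\<close> and
  \<open>b\<close> give it by algebra.\<close>

lemma positive_part_square_taylor:
  fixes a b :: real
  shows "\<bar>(max 0 b)\<^sup>2 - (max 0 a)\<^sup>2 - 2 * max 0 a * (b - a)\<bar> \<le> (b - a)\<^sup>2"
proof -
  consider "a \<le> 0" "b \<le> 0" | "a \<le> 0" "0 < b" | "0 < a" "b \<le> 0" | "0 < a" "0 < b" by linarith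
  then show ?thesis
  proof cases
    case 2
    then have "b\<^sup>2 \<le> (b - a)\<^sup>2" by (intro power_mono) auto
    with 2 show ?thesis by (simp add: max_def)
  next
    case 3
    then have "a * b \<le> 0" by (simp add: mult_nonneg_nonpos)
    with 3 show ?thesis by (simp add: max_def power2_eq_square algebra_simps)
  next
    case 4
    then have "(max 0 b)\<^sup>2 - (max 0 a)\<^sup>2 - 2 * max 0 a * (b - a) = (b - a)\<^sup>2"
      by (simp add: max_def power2_eq_square algebra_simps)
    then show ?thesis by simp
  qed (simp add: max_def)
qed

text \<open>Taylor expansion of the squared positive part at a = 1 - |v|^2. With t = |h|, the
  increments of the argument towards v + h and v - h are at most 5t in size, so each remainder is at
  most 25 t^2. In the second difference the linear terms cancel up to 4 t^2, so 54 = 25 + 25 + 4; in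
  the first difference the linear term adds 10 t, so 35 = 25 + 10.\<close>

lemma
  fixes v h :: "'a::euclidean_space"
  assumes h: "norm h \<le> 1"
  shows bump_diff_bound: "\<bar>bump (v + h) - bump v\<bar> \<le> 35 * norm h"
    and bump_second_diff_bound: "\<bar>bump (v + h) + bump (v - h) - 2 * bump v\<bar> \<le> 54 * (norm h)\<^sup>2"
proof -
  have "\<bar>bump (v + h) - bump v\<bar> \<le> 35 * norm h \<and>
      \<bar>bump (v + h) + bump (v - h) - 2 * bump v\<bar> \<le> 54 * (norm h)\<^sup>2"
  proof (cases "norm v \<le> 2")
    \<comment> \<open>Beyond radius 2 the points v, v + h and v - h all lie outside the unit ball,
      as |h| \<le> 1.\<close>
    case False
    then have "1 \<le> norm (v + h)" "1 \<le> norm (v - h)"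
      using norm_triangle_ineq2[of v "-h"] norm_triangle_ineq2[of v h] h by auto
    then show ?thesis using False by (simp add: bump_eq_0)
  next
    case True
    define t where "t = norm h"
    define a where "a = 1 - (norm v)\<^sup>2"
    define p where "p = 1 - (norm (v + h))\<^sup>2"
    define q where "q = 1 - (norm (v - h))\<^sup>2"
    have t: "0 \<le> t" "t \<le> 1" using h by (auto simp: t_def)
    have i: "\<bar>v \<bullet> h\<bar> \<le> 2 * t"
      using Cauchy_Schwarz_ineq2[of v h] mult_right_mono[OF True, of "norm h"] by (simp add: t_def)
    have pa: "p - a = - 2 * (v \<bullet> h) - t\<^sup>2" and qa: "q - a = 2 * (v \<bullet> h) - t\<^sup>2"
      by (simp_all add: p_def q_def a_def t_def power2_norm_eq_inner inner_add inner_diff inner_commute)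
    have "t\<^sup>2 \<le> t" using t by (simp add: power2_eq_square mult_left_le)
    with i pa qa zero_le_power2[of t]
    have pb: "\<bar>p - a\<bar> \<le> 5 * t" and qb: "\<bar>q - a\<bar> \<le> 5 * t" by linarith+
    have p2: "(p - a)\<^sup>2 \<le> 25 * t\<^sup>2" using power_mono[OF pb, of 2] by (simp add: power_mult_distrib)
    have q2: "(q - a)\<^sup>2 \<le> 25 * t\<^sup>2" using power_mono[OF qb, of 2] by (simp add: power_mult_distrib)
    have m: "0 \<le> max 0 a" "max 0 a \<le> 1" by (auto simp: a_def)
    define P where "P = (max 0 p)\<^sup>2 - (max 0 a)\<^sup>2 - 2 * max 0 a * (p - a)"
    define Q where "Q = (max 0 q)\<^sup>2 - (max 0 a)\<^sup>2 - 2 * max 0 a * (q - a)"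
    have P: "\<bar>P\<bar> \<le> 25 * t\<^sup>2" unfolding P_def using positive_part_square_taylor[of p a] p2 by linarith
    have Q: "\<bar>Q\<bar> \<le> 25 * t\<^sup>2" unfolding Q_def using positive_part_square_taylor[of q a] q2 by linarith
    have B: "bump (v + h) = (max 0 p)\<^sup>2" "bump (v - h) = (max 0 q)\<^sup>2" "bump v = (max 0 a)\<^sup>2"
      by (simp_all add: bump_def p_def q_def a_def)
    have "bump (v + h) + bump (v - h) - 2 * bump v = P + Q + 2 * max 0 a * ((p - a) + (q - a))"
      unfolding B P_def Q_def by (simp add: algebra_simps)
    also have "\<dots> = P + Q - 4 * (max 0 a * t\<^sup>2)" by (simp add: pa qa)
    finally have 2: "bump (v + h) + bump (v - h) - 2 * bump v = P + Q - 4 * (max 0 a * t\<^sup>2)" .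
    have "max 0 a * t\<^sup>2 \<le> 1 * t\<^sup>2" by (rule mult_right_mono[OF m(2)]) simp
    moreover have "0 \<le> max 0 a * t\<^sup>2" by simp
    ultimately have D2: "\<bar>bump (v + h) + bump (v - h) - 2 * bump v\<bar> \<le> 54 * t\<^sup>2" using 2 P Q by linarith
    have 1: "bump (v + h) - bump v = P + 2 * (max 0 a * (p - a))" unfolding B P_def by simp
    have "\<bar>max 0 a * (p - a)\<bar> \<le> 1 * (5 * t)"
      unfolding abs_mult using m pb by (intro mult_mono) auto
    with 1 P \<open>t\<^sup>2 \<le> t\<close> have "\<bar>bump (v + h) - bump v\<bar> \<le> 35 * t" by linarith
    with D2 show ?thesis by (simp add: t_def)
  qed
  then show "\<bar>bump (v + h) - bump v\<bar> \<le> 35 * norm h"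
    "\<bar>bump (v + h) + bump (v - h) - 2 * bump v\<bar> \<le> 54 * (norm h)\<^sup>2" by auto
qed

text \<open>A finite-difference form of C^{1,1} control at length \<open>e\<close>: first
  derivatives of order A/e and second ones of order A/e^2. The caps at 1 match the numerators of
  \<open>sing_kernel\<close> with m = 1 and m = 2.\<close>

definition smooth_at_scale :: "real \<Rightarrow> real \<Rightarrow> ('a::euclidean_space \<Rightarrow> real) \<Rightarrow> bool" where
  "smooth_at_scale A e \<eta> \<longleftrightarrow>
     (\<forall>x z. \<bar>\<eta> (x + z) - \<eta> x\<bar> \<le> A * min 1 (norm z / e)) \<and>
     (\<forall>x z. \<bar>\<eta> (x + z) + \<eta> (x - z) - 2 * \<eta> x\<bar> \<le> A * min 1 ((norm z / e)\<^sup>2))"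

text \<open>Take a weighted average of the indicator of \<open>S\<close> with the bump rescaled to
  radius \<open>e\<close>. Differences of \<eta> fall on the bump, and a ball of radius
  \<open>e\<close> inside or outside \<open>S\<close> sees a constant indicator.\<close>

lemma smooth_cutoff_exists:
  fixes S :: "'a::euclidean_space set"
  assumes e: "0 < e" and S[measurable]: "S \<in> sets borel"
  obtains \<eta> where "\<And>x. 0 \<le> \<eta> x" "\<And>x. \<eta> x \<le> 1" "smooth_at_scale (96 * 4 ^ DIM('a)) e \<eta>"
    "\<And>x. cball x e \<subseteq> S \<Longrightarrow> \<eta> x = 1" "\<And>x. cball x e \<inter> S = {} \<Longrightarrow> \<eta> x = 0"
proof -
  define R where "R x w = bump ((1 / e) *\<^sub>R (x - w))" for x w :: 'a
  define Z where "Z = (\<integral>w. R 0 w \<partial>lborel)"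
  define \<eta> where "\<eta> x = (\<integral>w. indicator S w * R x w \<partial>lborel) / Z" for x
  \<comment> \<open>54 is the second-difference constant of \<open>bump\<close>, 9/16 = (3/4)^2
    bounds the rescaled bump from below on the ball of radius e/2, and 4^n is the volume ratio of
    balls of radii 2e and e/2; 54 * 16/9 = 96.\<close>
  define A where "A = (96 * 4 ^ DIM('a) :: real)"
  have A2: "2 \<le> A" unfolding A_def using one_le_power[of "4::real" "DIM('a)"] by linarith
  have Rm[measurable]: "R x \<in> borel_measurable borel" for x unfolding R_def by measurable
  have R01: "0 \<le> R x w" "R x w \<le> 1" for x w by (simp_all add: R_def bump_nonneg bump_le_1)
  have R0: "R x w = 0" if "e \<le> dist x w" for x w
    using that e unfolding R_def by (intro bump_eq_0) (simp add: dist_norm)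
  have Rint: "integrable lborel (R x)" for x
    by (rule integrableI_bounded_set[where A = "cball x e" and B = 1])
       (use e R01 R0 in \<open>auto simp: emeasure_cball\<close>)
  have SRint: "integrable lborel (\<lambda>w. indicator S w * R x w)" for x
    by (rule Bochner_Integration.integrable_bound[OF Rint[of x]])
       (use R01 in \<open>auto simp: indicator_def\<close>)
  have RZ: "(\<integral>w. R x w \<partial>lborel) = Z" for x
  proof -
    have "(\<integral>w. R 0 w \<partial>lborel) = (\<integral>w. R 0 (x - w) \<partial>lborel)"
      by (rule lborel_integral_reflect[symmetric]) simp
    also have "\<dots> = (\<integral>w. R x w \<partial>lborel)"
      by (intro Bochner_Integration.integral_cong)
         (auto simp: R_def bump_def norm_minus_commute)
    finally show ?thesis by (simp add: Z_def)
  qed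
  define v where "v = measure lborel (cball (0::'a) (e / 2))"
  have v: "0 < v" using e by (simp add: v_def content_cball_pos)
  have v4: "measure lborel (cball x (2 * e)) = 4 ^ DIM('a) * v" for x :: 'a
  proof -
    have "(2 * e) ^ DIM('a) = 4 ^ DIM('a) * (e / 2) ^ DIM('a)"
      unfolding power_mult_distrib[symmetric] by simp
    then show ?thesis using e by (simp add: v_def content_cball)
  qed
  have "(\<integral>w. 9/16 * indicator (cball (0::'a) (e / 2)) w \<partial>lborel) \<le> (\<integral>w. R 0 w \<partial>lborel)"
  proof (rule Bochner_Integration.integral_mono)
    show "integrable lborel (\<lambda>w. 9 / 16 * indicat_real (cball (0::'a) (e / 2)) w)"
      by (auto simp: emeasure_cball e less_imp_le)
    fix w :: 'a
    show "9 / 16 * indicat_real (cball 0 (e / 2)) w \<le> R 0 w"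
    proof (cases "w \<in> cball 0 (e / 2)")
      case True
      then have "norm w / e \<le> 1 / 2" using e by (simp add: field_simps)
      then have "(norm w / e)\<^sup>2 \<le> (1 / 2)\<^sup>2" using e by (intro power_mono) auto
      also have "(1 / 2)\<^sup>2 = (1 / 4 :: real)" by (simp add: power2_eq_square)
      finally have "3 / 4 \<le> max 0 (1 - (norm w / e)\<^sup>2)" by linarith
      then have "(3 / 4)\<^sup>2 \<le> (max 0 (1 - (norm w / e)\<^sup>2))\<^sup>2" by (rule power_mono) simp
      then show ?thesis using True e by (simp add: R_def bump_def power_divide)
    qed (use R01 in auto)
  qed (rule Rint)
  then have Zv: "9 / 16 * v \<le> Z" by (simp add: Z_def v_def)
  then have Z: "0 < Z" using v by linarith
  \<comment> \<open>A function bounded by \<open>B\<close> and supported in a ball of radius 2e has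
    integral at most B 4^n v, and Z \<ge> (9/16) v absorbs the volume.\<close>
  have bound: "\<bar>\<integral>w. indicator S w * D w \<partial>lborel\<bar> / Z \<le> A / 54 * B"
    if D: "D \<in> borel_measurable borel" "\<And>w. \<bar>D w\<bar> \<le> B" "\<And>w. 2 * e < dist x w \<Longrightarrow> D w = 0" for D B x
  proof -
    note [measurable] = D(1)
    have B: "0 \<le> B" using D(2)[of x] by linarith
    have i: "integrable lborel (\<lambda>w. B * indicator (cball x (2 * e)) w)"
      using e by (auto simp: emeasure_cball)
    have le: "\<bar>indicator S w * D w\<bar> \<le> B * indicator (cball x (2 * e)) w" for w
      using D(2,3)[of w] B by (auto simp: indicator_def)
    have "\<bar>\<integral>w. indicator S w * D w \<partial>lborel\<bar> \<le> (\<integral>w. \<bar>indicator S w * D w\<bar> \<partial>lborel)"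
      by (rule integral_abs_bound)
    also have "\<dots> \<le> (\<integral>w. B * indicator (cball x (2 * e)) w \<partial>lborel)"
      by (rule integral_mono'[OF i]) (use le B in auto)
    also have "\<dots> = B * (4 ^ DIM('a) * v)" using v4[of x] by simp
    also have "\<dots> \<le> B * (4 ^ DIM('a) * (16 / 9 * Z))"
      using B Zv by (intro mult_left_mono) auto
    finally show ?thesis using Z by (simp add: A_def field_simps)
  qed
  have eta01: "0 \<le> \<eta> x" "\<eta> x \<le> 1" for x
  proof -
    have "0 \<le> (\<integral>w. indicator S w * R x w \<partial>lborel)" using R01 by (intro Bochner_Integration.integral_nonneg) auto
    moreover have "(\<integral>w. indicator S w * R x w \<partial>lborel) \<le> (\<integral>w. R x w \<partial>lborel)"
      by (intro Bochner_Integration.integral_mono SRint Rint) (use R01 in \<open>auto simp: indicator_def\<close>)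
    ultimately show "0 \<le> \<eta> x" "\<eta> x \<le> 1" using Z by (auto simp: \<eta>_def RZ)
  qed
  have sm: "smooth_at_scale A e \<eta>"
    unfolding smooth_at_scale_def
  proof (intro conjI allI)
    fix x z :: 'a
    define h where "h = (1 / e) *\<^sub>R z"
    have nh: "norm h = norm z / e" using e by (simp add: h_def)
    have Rh: "R (x + z) w = bump ((1 / e) *\<^sub>R (x - w) + h)" "R (x - z) w = bump ((1 / e) *\<^sub>R (x - w) - h)"
      "R x w = bump ((1 / e) *\<^sub>R (x - w))" for w
      by (simp_all add: R_def h_def algebra_simps)
    \<comment> \<open>For |z| \<le> e the three translated bumps live in the ball of radius 2e about
      \<open>x\<close>, as \<open>bound\<close> demands.\<close>
    have far: "R (x + z) w = 0 \<and> R (x - z) w = 0 \<and> R x w = 0" if "norm z \<le> e" "2 * e < dist x w" for w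
    proof -
      have "e \<le> dist (x + z) w" "e \<le> dist (x - z) w"
        using that norm_triangle_ineq2[of "x - w" "- z"] norm_triangle_ineq2[of "x - w" z]
        by (auto simp: dist_norm algebra_simps)
      then show ?thesis using that e by (simp add: R0)
    qed
    show "\<bar>\<eta> (x + z) - \<eta> x\<bar> \<le> A * min 1 (norm z / e)"
    proof (cases "norm z \<le> e")
      \<comment> \<open>For steps longer than \<open>e\<close> the cap is active, and 0 \<le> \<eta>
        \<le> 1 with A \<ge> 2 is enough, here and for the second difference.\<close>
      case False
      then have "min 1 (norm z / e) = 1" using e by (simp add: field_simps)
      then show ?thesis using eta01[of x] eta01[of "x + z"] A2 by (simp add: abs_if)
    next
      case True
      then have "norm h \<le> 1" using e by (simp add: nh)
      have "\<bar>\<eta> (x + z) - \<eta> x\<bar> = \<bar>\<integral>w. indicator S w * (R (x + z) w - R x w) \<partial>lborel\<bar> / Z"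
        using Z by (simp add: \<eta>_def right_diff_distrib SRint diff_divide_distrib[symmetric])
      also have "\<dots> \<le> A / 54 * (35 * norm h)"
        by (rule bound[where x = x])
           (use far[OF True] bump_diff_bound[OF \<open>norm h \<le> 1\<close>] in \<open>auto simp: Rh(1,3)\<close>)
      also have "\<dots> \<le> A * norm h" using A2 by (simp add: field_simps mult_left_mono)
      finally show ?thesis unfolding nh[symmetric] using \<open>norm h \<le> 1\<close> by (simp add: min_absorb2)
    qed
    show "\<bar>\<eta> (x + z) + \<eta> (x - z) - 2 * \<eta> x\<bar> \<le> A * min 1 ((norm z / e)\<^sup>2)"
    proof (cases "norm z \<le> e")
      case False
      then have "1 \<le> (norm z / e)\<^sup>2" using e by (intro one_le_power) (simp add: field_simps)
      then have "min 1 ((norm z / e)\<^sup>2) = 1" by simp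
      then show ?thesis using eta01[of x] eta01[of "x + z"] eta01[of "x - z"] A2 by (simp add: abs_if)
    next
      case True
      then have "norm h \<le> 1" using e by (simp add: nh)
      have "\<bar>\<eta> (x + z) + \<eta> (x - z) - 2 * \<eta> x\<bar> = \<bar>\<integral>w. indicator S w * R (x + z) w
          + indicator S w * R (x - z) w - 2 * (indicator S w * R x w) \<partial>lborel\<bar> / Z"
        using Z by (simp add: \<eta>_def SRint diff_divide_distrib[symmetric] add_divide_distrib[symmetric])
      also have "\<dots> = \<bar>\<integral>w. indicator S w * (R (x + z) w + R (x - z) w - 2 * R x w) \<partial>lborel\<bar> / Z"
        by (simp add: algebra_simps)
      also have "\<dots> \<le> A / 54 * (54 * (norm h)\<^sup>2)"
        by (rule bound[where x = x])
           (use far[OF True] bump_second_diff_bound[OF \<open>norm h \<le> 1\<close>] in \<open>auto simp: Rh\<close>)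
      finally show ?thesis unfolding nh[symmetric] using \<open>norm h \<le> 1\<close> by (simp add: min_absorb2 power_le_one)
    qed
  qed
  have one: "\<eta> x = 1" if "cball x e \<subseteq> S" for x
  proof -
    have "indicator S w * R x w = R x w" for w
      using that R0[of x w] by (cases "w \<in> cball x e") auto
    then have "\<eta> x = (\<integral>w. R x w \<partial>lborel) / Z" unfolding \<eta>_def by (simp only:)
    then show ?thesis using Z by (simp add: RZ)
  qed
  have zero: "\<eta> x = 0" if "cball x e \<inter> S = {}" for x
  proof -
    have "indicator S w * R x w = 0" for w
      using that R0[of x w] by (cases "w \<in> cball x e") (auto simp: indicator_def disjoint_iff)
    then have "\<eta> x = (\<integral>w. 0 \<partial>(lborel :: 'a measure)) / Z" unfolding \<eta>_def by (simp only:)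
    then show ?thesis by simp
  qed
  show ?thesis using that[OF eta01 sm[unfolded A_def] one zero] by blast
qed

lemma smooth_at_scale_continuous:
  fixes \<eta> :: "'a::euclidean_space \<Rightarrow> real"
  assumes "smooth_at_scale A e \<eta>" "0 < e" "0 \<le> A"
  shows "continuous_on UNIV \<eta>"
proof -
  have "(A / e)-lipschitz_on UNIV \<eta>"
  proof (rule lipschitz_onI)
    fix x y :: 'a
    have "\<bar>\<eta> (y + (x - y)) - \<eta> y\<bar> \<le> A * min 1 (norm (x - y) / e)"
      using assms unfolding smooth_at_scale_def by blast
    also have "\<dots> \<le> A * (norm (x - y) / e)" using assms by (intro mult_left_mono) auto
    finally show "dist (\<eta> x) (\<eta> y) \<le> A / e * dist x y" by (simp add: dist_norm)
  qed (use assms in simp)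
  then show ?thesis by (rule lipschitz_on_continuous_on)
qed

section \<open>Hoelder functions and truncated integrals\<close>

lemma holder_continuous_on:
  fixes \<phi> :: "'a::metric_space \<Rightarrow> real"
  assumes H: "\<And>x y. \<bar>\<phi> x - \<phi> y\<bar> \<le> H * dist x y powr s" and s: "0 < s"
  shows "continuous_on UNIV \<phi>"
proof -
  have "(\<phi> \<longlongrightarrow> \<phi> x) (at x)" for x
  proof -
    have "((\<lambda>y. H * dist y x powr s) \<longlongrightarrow> H * 0 powr s) (at x)"
      by (intro tendsto_intros tendsto_powr') (use s in \<open>auto intro!: tendsto_eq_intros\<close>)
    then have "((\<lambda>y. H * dist y x powr s) \<longlongrightarrow> 0) (at x)" using s by simp
    then have "((\<lambda>y. \<phi> y - \<phi> x) \<longlongrightarrow> 0) (at x)"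
      by (rule Lim_null_comparison[rotated]) (use H in \<open>auto intro!: always_eventually\<close>)
    then show ?thesis by (rule LIM_zero_cancel)
  qed
  then show ?thesis by (simp add: continuous_on_def)
qed

lemma holder_const_nonneg:
  fixes \<phi> :: "real^'n::finite \<Rightarrow> real"
  assumes H: "\<And>x y. \<bar>\<phi> x - \<phi> y\<bar> \<le> H * dist x y powr s"
  shows "0 \<le> H"
  using H[of 0 1] zero_neq_one[where 'a = "real^'n"]
  by (smt (verit) abs_ge_zero mult_neg_pos powr_gt_zero zero_less_dist_iff)

text \<open>Dominated convergence with majorant |g|; the truncations converge to \<open>g\<close>
  off the null set {x}. Replacing \<tau> by its inverse turns the limit at 0+ into one at
  infinity.\<close>

lemma tendsto_truncated_integral:
  fixes g :: "'a::euclidean_space \<Rightarrow> real"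
  assumes g: "integrable lborel g"
  shows "((\<lambda>\<tau>. \<integral>y. indicator {y. \<tau> < dist x y} y * g y \<partial>lborel) \<longlongrightarrow> (\<integral>y. g y \<partial>lborel)) (at_right 0)"
  unfolding filterlim_at_right_to_top
proof (rule integral_dominated_convergence_at_top[where w = "\<lambda>y. \<bar>g y\<bar>"])
  have [measurable]: "g \<in> borel_measurable borel" using g by auto
  show "(\<lambda>y. indicator {y. inverse \<tau> < dist x y} y * g y) \<in> borel_measurable lborel" for \<tau> by measurable
  show "g \<in> borel_measurable lborel" by measurable
  show "integrable lborel (\<lambda>y. \<bar>g y\<bar>)" using g by simp
  show "\<forall>\<^sub>F \<tau> in at_top. AE y in lborel. norm (indicator {y. inverse \<tau> < dist x y} y * g y) \<le> \<bar>g y\<bar>"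
    by (auto intro!: always_eventually simp: indicator_def)
  show "AE y in lborel. ((\<lambda>\<tau>. indicator {y. inverse \<tau> < dist x y} y * g y) \<longlongrightarrow> g y) at_top"
    using AE_lborel_singleton[of x]
  proof eventually_elim
    case (elim y)
    have "\<forall>\<^sub>F \<tau> in at_top. inverse \<tau> < dist x y"
      using elim by (intro order_tendstoD(2)[OF tendsto_inverse_0_at_top[OF filterlim_ident]]) auto
    then have "\<forall>\<^sub>F \<tau> in at_top. indicator {y. inverse \<tau> < dist x y} y * g y = g y"
      by eventually_elim simp
    then show ?case by (rule tendsto_eventually)
  qed
qed

section \<open>The fractional Laplacian of a product\<close>

abbreviation diff_quot :: "real \<Rightarrow> (real^'n::finite \<Rightarrow> real) \<Rightarrow> real^'n \<Rightarrow> real^'n \<Rightarrow> real" where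
  "diff_quot s \<psi> x y \<equiv> (\<psi> x - \<psi> y) / norm (x - y) powr (real CARD('n) + 2 * s)"

text \<open>Over \<open>lborel\<close> the reflection lemmas apply, and the integral is Borel
  measurable in the parameter \<open>x\<close>.\<close>

lemma frac_trunc_lborel:
  fixes \<psi> :: "real^'n::finite \<Rightarrow> real"
  assumes [measurable]: "\<psi> \<in> borel_measurable borel"
  shows "frac_trunc s \<psi> x \<tau> = (\<integral>y. indicator {y. \<tau> < dist x y} y * diff_quot s \<psi> x y \<partial>lborel)"
  unfolding frac_trunc_def set_lebesgue_integral_def
  by (subst integral_completion) (auto simp del: times_divide_eq_right)

lemma frac_trunc_integrable_lborel:
  fixes \<psi> :: "real^'n::finite \<Rightarrow> real"
  assumes [measurable]: "\<psi> \<in> borel_measurable borel"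
  shows "set_integrable lebesgue {y. dist x y > \<tau>}
           (\<lambda>y. (\<psi> x - \<psi> y) / norm (x - y) powr (real CARD('n) + 2 * s))
     \<longleftrightarrow> integrable lborel (\<lambda>y. indicator {y. \<tau> < dist x y} y * diff_quot s \<psi> x y)"
  unfolding set_integrable_def
  by (subst integrable_completion) (auto simp del: times_divide_eq_right)

text \<open>\<open>Lim\<close> carries information only where the limit exists;
  \<open>frac_lap_exists\<close> turns it into a convergence statement.\<close>

lemma frac_lap_tendsto:
  assumes "frac_lap_exists s \<psi> (x :: real^'n::finite)"
  shows "((\<lambda>\<tau>. frac_const TYPE('n) s * frac_trunc s \<psi> x \<tau>) \<longlongrightarrow> frac_lap s \<psi> x) (at_right 0)"
proof -
  obtain L where L: "(frac_trunc s \<psi> x \<longlongrightarrow> L) (at_right 0)"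
    using assms by (auto simp: frac_lap_exists_def)
  have "Lim (at_right 0) (frac_trunc s \<psi> x) = L"
    using L by (intro tendsto_Lim) auto
  with L show ?thesis unfolding frac_lap_def by (intro tendsto_mult tendsto_const) auto
qed

text \<open>On \<Omega> the fractional Laplacian is the pointwise limit of the truncations at
  1/(k+1), each a parametric integral and hence Borel in \<open>x\<close>.\<close>

lemma frac_lap_measurable:
  fixes \<psi> :: "real^'n::finite \<Rightarrow> real"
  assumes [measurable]: "\<psi> \<in> borel_measurable borel" "\<Omega> \<in> sets borel"
    and ex: "\<And>x. x \<in> \<Omega> \<Longrightarrow> frac_lap_exists s \<psi> x"
  shows "set_borel_measurable lebesgue \<Omega> (frac_lap s \<psi>)"
proof -
  let ?T = "\<lambda>k x. indicator \<Omega> x * (frac_const TYPE('n) s * frac_trunc s \<psi> x (inverse (real (Suc k))))"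
  have m: "?T k \<in> borel_measurable borel" for k
    unfolding frac_trunc_lborel[OF assms(1)] by measurable
  have "(\<lambda>x. indicator \<Omega> x * frac_lap s \<psi> x) \<in> borel_measurable borel"
  proof (rule borel_measurable_LIMSEQ_real[OF _ m])
    fix x
    have f: "filterlim (\<lambda>k. inverse (real (Suc k))) (at_right 0) sequentially"
      by (rule filterlim_compose[OF filterlim_inverse_at_right_top])
         (rule filterlim_compose[OF filterlim_real_sequentially filterlim_Suc])
    show "(\<lambda>k. ?T k x) \<longlonglongrightarrow> indicator \<Omega> x * frac_lap s \<psi> x"
    proof (cases "x \<in> \<Omega>")
      case True
      then show ?thesis using filterlim_compose[OF frac_lap_tendsto[OF ex[OF True]] f] by simp
    qed simp
  qed
  then show ?thesis by (simp add: set_borel_measurable_def measurable_completion)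
qed

text \<open>Two estimates with one constant depending only on n and s. The first is a commutator
  bound: the difference of \<phi> \<eta> equals \<eta>(x) times that of \<phi>, plus \<phi>(x) times
  that of \<eta>, minus the product of both differences. The last two parts are handled by
  \<open>sing_kernel\<close> with (m, b) = (2, 2s) and (1, s), where s < 1 gives b < m. The second
  is a locality bound: functions agreeing within distance \<open>r\<close> of \<open>x\<close>
  interact only through the tail of the kernel, of mass r^(-2s).\<close>

lemma frac_lap_product:
  assumes s: "0 < s" "s < 1"
  obtains K where "0 \<le> K"
    "\<And>e A H \<eta> \<phi> (x :: real^'n::finite).
       \<lbrakk>0 < e; 0 \<le> A; smooth_at_scale A e \<eta>; \<phi> \<in> borel_measurable borel;
        \<And>x y. \<bar>\<phi> x - \<phi> y\<bar> \<le> H * dist x y powr s; frac_lap_exists s \<phi> x\<rbrakk> \<Longrightarrow>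
       frac_lap_exists s (\<lambda>y. \<phi> y * \<eta> y) x \<and>
       \<bar>frac_lap s (\<lambda>y. \<phi> y * \<eta> y) x - \<eta> x * frac_lap s \<phi> x\<bar>
         \<le> K * A * (\<bar>\<phi> x\<bar> * e powr (- 2 * s) + H * e powr (- s))"
    "\<And>r B \<phi> \<psi> (x :: real^'n::finite).
       \<lbrakk>0 < r; \<phi> \<in> borel_measurable borel; \<psi> \<in> borel_measurable borel;
        \<And>y. \<bar>\<phi> y - \<psi> y\<bar> \<le> B; \<And>y. dist x y < r \<Longrightarrow> \<psi> y = \<phi> y;
        frac_lap_exists s \<phi> x; frac_lap_exists s \<psi> x\<rbrakk> \<Longrightarrow>
       \<bar>frac_lap s \<psi> x - frac_lap s \<phi> x\<bar> \<le> K * B * r powr (- 2 * s)"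
proof -
  obtain C1 where C1: "0 \<le> C1"
    "\<And>e (x::real^'n). 0 < e \<Longrightarrow> integrable lborel (sing_kernel 1 s e x)"
    "\<And>e (x::real^'n). 0 < e \<Longrightarrow> (\<integral>y. sing_kernel 1 s e x y \<partial>lborel) \<le> C1 * e powr (- s)"
    using sing_kernel_integral_bound[of s 1] s by metis
  obtain C2 where C2: "0 \<le> C2"
    "\<And>e (x::real^'n). 0 < e \<Longrightarrow> integrable lborel (sing_kernel 2 (2 * s) e x)"
    "\<And>e (x::real^'n). 0 < e \<Longrightarrow> (\<integral>y. sing_kernel 2 (2 * s) e x y \<partial>lborel) \<le> C2 * e powr (- (2 * s))"
    using sing_kernel_integral_bound[of "2 * s" 2] s by (metis mult_pos_pos zero_less_numeral mult_less_cancel_left_pos mult.right_neutral)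
  define N where "N = real CARD('n)"
  define c where "c = frac_const TYPE('n) s"
  define K where "K = \<bar>c\<bar> * (C1 + C2)"
  have K0: "0 \<le> K" using C1 C2 by (simp add: K_def)
  have inv_p: "dist x y powr (- (2 * s) - real DIM(real^'n)) = 1 / norm (x - y) powr (N + 2 * s)" for x y :: "real^'n"
  proof -
    have "- (2 * s) - real DIM(real^'n) = - (N + 2 * s)" by (simp add: N_def)
    then show ?thesis by (simp only: powr_minus_divide dist_norm)
  qed
  let ?I = "\<lambda>\<tau> x y. indicator {y. \<tau> < dist x y} y :: real"
  have bnd: "integrable lborel g \<and> \<bar>\<integral>y. g y \<partial>lborel\<bar> \<le> B * C"
    if "integrable lborel k" "(\<integral>y. k y \<partial>lborel) \<le> C" "g \<in> borel_measurable borel" "0 \<le> B"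
      "\<And>y. \<bar>g y\<bar> \<le> B * k y" for g k :: "real^'n \<Rightarrow> real" and B C :: real
  proof
    have i: "integrable lborel (\<lambda>y. B * k y)" using that by auto
    show g: "integrable lborel g"
      by (rule Bochner_Integration.integrable_bound[OF i])
         (use that(3,5) in \<open>auto intro: order_trans[OF _ abs_ge_self]\<close>)
    have "\<bar>\<integral>y. g y \<partial>lborel\<bar> \<le> (\<integral>y. \<bar>g y\<bar> \<partial>lborel)" by (rule integral_abs_bound)
    also have "\<dots> \<le> (\<integral>y. B * k y \<partial>lborel)" by (intro Bochner_Integration.integral_mono i) (use g that in auto)
    also have "\<dots> \<le> B * C" using that by (simp add: mult_left_mono)
    finally show "\<bar>\<integral>y. g y \<partial>lborel\<bar> \<le> B * C" .
  qed
  \<comment> \<open>At distance at least \<open>r\<close> the cap in \<open>sing_kernel\<close>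
    equals 1, so the tail of the kernel is \<open>sing_kernel\<close> with scale \<open>r\<close>.
    This serves both the truncated quotients of \<eta>, with r = \<tau>, and the locality
    estimate.\<close>
  have far: "integrable lborel (\<lambda>y. g y / norm (x - y) powr (N + 2 * s)) \<and>
      \<bar>\<integral>y. g y / norm (x - y) powr (N + 2 * s) \<partial>lborel\<bar> \<le> B * (C2 * r powr (- (2 * s)))"
    if r: "0 < r" and [measurable]: "g \<in> borel_measurable borel"
      and B: "\<And>y. \<bar>g y\<bar> \<le> B" and z: "\<And>y. dist x y < r \<Longrightarrow> g y = 0"
    for g :: "real^'n \<Rightarrow> real" and x r B
  proof (rule bnd[OF C2(2)[OF r] C2(3)[OF r]])
    show B0: "0 \<le> B" using B[of x] by linarith
    show "\<bar>g y / norm (x - y) powr (N + 2 * s)\<bar> \<le> B * sing_kernel 2 (2 * s) r x y" for y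
    proof (cases "dist x y < r")
      case True
      then show ?thesis using z[of y] B0 by (simp add: sing_kernel_nonneg)
    next
      case False
      then have "1 \<le> (dist x y / r) powr 2" using r by (intro ge_one_powr_ge_zero) auto
      then have "sing_kernel 2 (2 * s) r x y = 1 / norm (x - y) powr (N + 2 * s)"
        unfolding sing_kernel_def inv_p by simp
      then show ?thesis using B[of y] by (simp add: divide_right_mono)
    qed
  qed measurable
  show ?thesis
  proof (rule that[OF K0])
    fix e A H :: real and \<eta> \<phi> :: "real^'n \<Rightarrow> real" and x :: "real^'n"
    assume e: "0 < e" and A: "0 \<le> A" and sm: "smooth_at_scale A e \<eta>"
      and [measurable]: "\<phi> \<in> borel_measurable borel"
      and H: "\<And>x y. \<bar>\<phi> x - \<phi> y\<bar> \<le> H * dist x y powr s" and ex: "frac_lap_exists s \<phi> x"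
    have [measurable]: "\<eta> \<in> borel_measurable borel"
      using smooth_at_scale_continuous[OF sm e A] by (rule borel_measurable_continuous_onI)
    define \<psi> where "\<psi> y = \<phi> y * \<eta> y" for y
    have [measurable]: "\<psi> \<in> borel_measurable borel" unfolding \<psi>_def by measurable
    have \<eta>1: "\<bar>\<eta> x - \<eta> y\<bar> \<le> A * min 1 (dist x y / e)" for y
    proof -
      have "\<bar>\<eta> (x + (y - x)) - \<eta> x\<bar> \<le> A * min 1 (norm (y - x) / e)"
        using sm unfolding smooth_at_scale_def by blast
      then show ?thesis by (simp add: dist_norm norm_minus_commute abs_minus_commute)
    qed
    have \<eta>2: "\<bar>2 * \<eta> x - \<eta> y - \<eta> (2 *\<^sub>R x - y)\<bar> \<le> A * min 1 ((dist x y / e)\<^sup>2)" for y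
    proof -
      have "\<bar>\<eta> (x + (y - x)) + \<eta> (x - (y - x)) - 2 * \<eta> x\<bar> \<le> A * min 1 ((norm (y - x) / e)\<^sup>2)"
        using sm unfolding smooth_at_scale_def by blast
      moreover have "x - (y - x) = 2 *\<^sub>R x - y" by (simp add: scaleR_2)
      ultimately show ?thesis by (simp add: dist_norm norm_minus_commute)
    qed
    have H0: "0 \<le> H" by (rule holder_const_nonneg[OF H])
    \<comment> \<open>The first difference of \<eta>, its symmetrisation under y \<mapsto> 2x - y,
      and the bilinear term of the product rule. The kernel bounds make \<open>S\<close> and
      \<open>B\<close> integrable without truncation.\<close>
    define D where "D y = diff_quot s \<eta> x y" for y
    define S where "S y = (2 * \<eta> x - \<eta> y - \<eta> (2 *\<^sub>R x - y)) / norm (x - y) powr (N + 2 * s)" for y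
    define B where "B y = (\<phi> x - \<phi> y) * (\<eta> x - \<eta> y) / norm (x - y) powr (N + 2 * s)" for y
    have [measurable]: "D \<in> borel_measurable borel" "S \<in> borel_measurable borel" "B \<in> borel_measurable borel"
      unfolding D_def S_def B_def by measurable
    have S: "integrable lborel S" "\<bar>\<integral>y. S y \<partial>lborel\<bar> \<le> A * (C2 * e powr (- (2 * s)))"
    proof -
      have "\<bar>S y\<bar> \<le> A * sing_kernel 2 (2 * s) e x y" for y
      proof (cases "x = y")
        case False
        then have "(dist x y / e)\<^sup>2 = (dist x y / e) powr 2" using e by simp
        then have "sing_kernel 2 (2 * s) e x y = min 1 ((dist x y / e)\<^sup>2) / norm (x - y) powr (N + 2 * s)"
          unfolding sing_kernel_def inv_p by simp
        then show ?thesis using \<eta>2[of y] by (simp add: S_def divide_right_mono)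
      qed (simp add: S_def sing_kernel_def)
      then show "integrable lborel S" "\<bar>\<integral>y. S y \<partial>lborel\<bar> \<le> A * (C2 * e powr (- (2 * s)))"
        using bnd[OF C2(2)[OF e] C2(3)[OF e] _ A, of S x] by auto
    qed
    have B: "integrable lborel B" "\<bar>\<integral>y. B y \<partial>lborel\<bar> \<le> H * A * (C1 * e powr (- s))"
    proof -
      have "\<bar>B y\<bar> \<le> H * A * sing_kernel 1 s e x y" for y
      proof (cases "x = y")
        case False
        have "\<bar>(\<phi> x - \<phi> y) * (\<eta> x - \<eta> y)\<bar> \<le> (H * dist x y powr s) * (A * min 1 (dist x y / e))"
          unfolding abs_mult using H0 by (intro mult_mono H \<eta>1) auto
        then have "\<bar>B y\<bar> \<le> (H * dist x y powr s) * (A * min 1 (dist x y / e)) / norm (x - y) powr (N + 2 * s)"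
          by (simp add: B_def divide_right_mono)
        also have "\<dots> = H * A * (min 1 (dist x y / e) * (dist x y powr s / dist x y powr (N + 2 * s)))"
          by (simp add: dist_norm)
        also have "dist x y powr s / dist x y powr (N + 2 * s) = dist x y powr (- s - N)"
          by (simp add: powr_diff[symmetric])
        finally show ?thesis using False e by (simp add: sing_kernel_def N_def)
      qed (simp add: B_def sing_kernel_def)
      then show "integrable lborel B" "\<bar>\<integral>y. B y \<partial>lborel\<bar> \<le> H * A * (C1 * e powr (- s))"
        using bnd[OF C1(2)[OF e] C1(3)[OF e] _ mult_nonneg_nonneg[OF H0 A], of B x] by auto
    qed
    have iI: "integrable lborel (\<lambda>y. ?I \<tau> x y * g y)" if "integrable lborel g" for \<tau> and g :: "real^'n \<Rightarrow> real"
    proof (rule Bochner_Integration.integrable_bound[OF that])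
      have [measurable]: "g \<in> borel_measurable borel" using that by auto
      show "(\<lambda>y. ?I \<tau> x y * g y) \<in> borel_measurable lborel" by measurable
    qed (auto simp: indicator_def)
    have iD: "integrable lborel (\<lambda>y. ?I \<tau> x y * D y)" if "0 < \<tau>" for \<tau>
    proof -
      have "A * min 1 (dist x y / e) \<le> A * 1" for y using A by (intro mult_left_mono) auto
      then have "\<bar>?I \<tau> x y * (\<eta> x - \<eta> y)\<bar> \<le> A" for y
        using \<eta>1[of y] A by (auto simp: indicator_def intro: order_trans)
      then show ?thesis
        using far[OF that, of "\<lambda>y. ?I \<tau> x y * (\<eta> x - \<eta> y)" A x] by (simp add: D_def N_def)
    qed
    \<comment> \<open>Averaging with the reflection \<open>y \<mapsto> 2x - y\<close> turns the first difference of \<open>\<eta>\<close>, whose quotient is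
      not integrable for \<open>s \<ge> 1/2\<close>, into a second difference.\<close>
    have DS: "(\<integral>y. ?I \<tau> x y * D y \<partial>lborel) = 1/2 * (\<integral>y. ?I \<tau> x y * S y \<partial>lborel)" if "0 < \<tau>" for \<tau>
    proof -
      let ?g = "\<lambda>y. ?I \<tau> x y * D y"
      have d: "dist x (2 *\<^sub>R x - y) = dist x y" "norm (x - (2 *\<^sub>R x - y)) = norm (x - y)" for y
        by (simp_all add: dist_norm scaleR_2 norm_minus_commute)
      have r: "(\<integral>y. ?g (2 *\<^sub>R x - y) \<partial>lborel) = (\<integral>y. ?g y \<partial>lborel)"
        by (rule lborel_integral_reflect) measurable
      have ir: "integrable lborel (\<lambda>y. ?g (2 *\<^sub>R x - y))"
        by (subst lborel_integrable_reflect) (use iD[OF that] in auto)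
      have "?I \<tau> x y * S y = ?g y + ?g (2 *\<^sub>R x - y)" for y
        unfolding S_def D_def N_def d by (auto simp: indicator_def d add_divide_distrib[symmetric])
      then have "(\<integral>y. ?I \<tau> x y * S y \<partial>lborel) = (\<integral>y. ?g y \<partial>lborel) + (\<integral>y. ?g (2 *\<^sub>R x - y) \<partial>lborel)"
        by (simp only: Bochner_Integration.integral_add[OF iD[OF that] ir])
      then show ?thesis unfolding r by simp
    qed
    have iphi: "integrable lborel (\<lambda>y. ?I \<tau> x y * diff_quot s \<phi> x y)" if "0 < \<tau>" for \<tau>
      using ex that by (simp add: frac_lap_exists_def frac_trunc_integrable_lborel)
    have prod: "?I \<tau> x y * diff_quot s \<psi> x y =
        \<eta> x * (?I \<tau> x y * diff_quot s \<phi> x y) + \<phi> x * (?I \<tau> x y * D y) - ?I \<tau> x y * B y" for \<tau> y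
      unfolding D_def B_def \<psi>_def N_def by (simp add: diff_divide_distrib add_divide_distrib algebra_simps)
    have ipsi: "integrable lborel (\<lambda>y. ?I \<tau> x y * diff_quot s \<psi> x y)" if "0 < \<tau>" for \<tau>
      unfolding prod
      by (intro Bochner_Integration.integrable_diff Bochner_Integration.integrable_add
          integrable_mult_right iphi iD iI B that)
    have T: "frac_trunc s \<psi> x \<tau> = \<eta> x * frac_trunc s \<phi> x \<tau>
        + \<phi> x * (1/2 * (\<integral>y. ?I \<tau> x y * S y \<partial>lborel)) - (\<integral>y. ?I \<tau> x y * B y \<partial>lborel)" if "0 < \<tau>" for \<tau>
      unfolding DS[OF that, symmetric] frac_trunc_lborel[OF \<open>\<psi> \<in> _\<close>] frac_trunc_lborel[OF \<open>\<phi> \<in> _\<close>] prod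
      using iphi[OF that] iD[OF that] iI[OF B(1)]
      by (simp only: Bochner_Integration.integral_add Bochner_Integration.integral_diff
          Bochner_Integration.integrable_add integrable_mult_right integral_mult_right_zero simp_thms)
    obtain L where L: "(frac_trunc s \<phi> x \<longlongrightarrow> L) (at_right 0)"
      using ex by (auto simp: frac_lap_exists_def)
    \<comment> \<open>The correction that survives the limit \<tau> \<rightarrow> 0: the truncated
      integrals of \<open>S\<close> and \<open>B\<close> converge to full ones, so the only
      principal value left is that of \<phi>, with limit \<open>L\<close>.\<close>
    define E where "E = \<phi> x * (1/2 * (\<integral>y. S y \<partial>lborel)) - (\<integral>y. B y \<partial>lborel)"
    have "((\<lambda>\<tau>. \<eta> x * frac_trunc s \<phi> x \<tau> + \<phi> x * (1/2 * (\<integral>y. ?I \<tau> x y * S y \<partial>lborel))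
        - (\<integral>y. ?I \<tau> x y * B y \<partial>lborel)) \<longlongrightarrow> \<eta> x * L + \<phi> x * (1/2 * (\<integral>y. S y \<partial>lborel)) - (\<integral>y. B y \<partial>lborel)) (at_right 0)"
      by (intro tendsto_intros L tendsto_truncated_integral S B)
    then have lim: "(frac_trunc s \<psi> x \<longlongrightarrow> \<eta> x * L + E) (at_right 0)"
      unfolding E_def add_diff_eq[symmetric]
      by (rule Lim_transform_eventually) (auto simp: eventually_at_right_less T add_diff_eq intro!: eventually_mono[OF eventually_at_right_less[of 0]])
    then have ex\<psi>: "frac_lap_exists s \<psi> x"
      using ipsi unfolding frac_lap_exists_def by (auto simp: frac_trunc_integrable_lborel)
    have "Lim (at_right 0) (frac_trunc s \<psi> x) = \<eta> x * L + E" "Lim (at_right 0) (frac_trunc s \<phi> x) = L"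
      using lim L by (auto intro!: tendsto_Lim)
    then have eq: "frac_lap s \<psi> x - \<eta> x * frac_lap s \<phi> x = c * E"
      by (simp add: frac_lap_def c_def algebra_simps)
    have "\<bar>E\<bar> \<le> \<bar>\<phi> x\<bar> * (1/2 * \<bar>\<integral>y. S y \<partial>lborel\<bar>) + \<bar>\<integral>y. B y \<partial>lborel\<bar>"
      unfolding E_def by (rule order_trans[OF abs_triangle_ineq4]) (simp add: abs_mult)
    also have "\<dots> \<le> \<bar>\<phi> x\<bar> * (A * (C2 * e powr (- (2 * s)))) + H * A * (C1 * e powr (- s))"
      using S(2) B(2) by (intro add_mono mult_left_mono) auto
    \<comment> \<open>Enlarging \<open>C1\<close> and \<open>C2\<close> to their sum lets the single
      constant \<open>K\<close> serve both terms.\<close>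
    also have "\<dots> \<le> \<bar>\<phi> x\<bar> * (A * ((C1 + C2) * e powr (- (2 * s)))) + H * A * ((C1 + C2) * e powr (- s))"
      using A H0 C1(1) C2(1) by (intro add_mono mult_left_mono mult_right_mono) auto
    finally have "\<bar>c * E\<bar> \<le> \<bar>c\<bar> * (\<bar>\<phi> x\<bar> * (A * ((C1 + C2) * e powr (- (2 * s)))) + H * A * ((C1 + C2) * e powr (- s)))"
      unfolding abs_mult by (rule mult_left_mono) simp
    then have "\<bar>frac_lap s \<psi> x - \<eta> x * frac_lap s \<phi> x\<bar> \<le> K * A * (\<bar>\<phi> x\<bar> * e powr (- 2 * s) + H * e powr (- s))"
      unfolding eq K_def by (simp add: algebra_simps)
    with ex\<psi> show "frac_lap_exists s (\<lambda>y. \<phi> y * \<eta> y) x \<and>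
       \<bar>frac_lap s (\<lambda>y. \<phi> y * \<eta> y) x - \<eta> x * frac_lap s \<phi> x\<bar>
         \<le> K * A * (\<bar>\<phi> x\<bar> * e powr (- 2 * s) + H * e powr (- s))"
      by (simp add: \<psi>_def[abs_def])
  next
    fix r B :: real and \<phi> \<psi> :: "real^'n \<Rightarrow> real" and x :: "real^'n"
    assume r: "0 < r" and [measurable]: "\<phi> \<in> borel_measurable borel" "\<psi> \<in> borel_measurable borel"
      and B: "\<And>y. \<bar>\<phi> y - \<psi> y\<bar> \<le> B" and near: "\<And>y. dist x y < r \<Longrightarrow> \<psi> y = \<phi> y"
      and ex: "frac_lap_exists s \<phi> x" "frac_lap_exists s \<psi> x"
    have B0: "0 \<le> B" using B[of x] by linarith
    have i: "integrable lborel (\<lambda>y. ?I \<tau> x y * diff_quot s \<phi> x y)"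
      "integrable lborel (\<lambda>y. ?I \<tau> x y * diff_quot s \<psi> x y)" if "0 < \<tau>" for \<tau>
      using ex that by (simp_all add: frac_lap_exists_def frac_trunc_integrable_lborel)
    have T: "\<bar>c * frac_trunc s \<psi> x \<tau> - c * frac_trunc s \<phi> x \<tau>\<bar> \<le> \<bar>c\<bar> * (B * (C2 * r powr (- (2 * s))))"
      if "0 < \<tau>" for \<tau>
    proof -
      have "frac_trunc s \<psi> x \<tau> - frac_trunc s \<phi> x \<tau>
          = (\<integral>y. ?I \<tau> x y * diff_quot s \<psi> x y - ?I \<tau> x y * diff_quot s \<phi> x y \<partial>lborel)"
        unfolding frac_trunc_lborel[OF \<open>\<psi> \<in> _\<close>] frac_trunc_lborel[OF \<open>\<phi> \<in> _\<close>]
        by (rule Bochner_Integration.integral_diff[symmetric, OF i(2,1)[OF that]])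
      \<comment> \<open>The centre values agree because dist x x = 0 < r, so only the values at
        \<open>y\<close> remain in the numerator, and these vanish for \<open>y\<close> within
        distance \<open>r\<close>.\<close>
      also have "\<dots> = (\<integral>y. ?I \<tau> x y * (\<phi> y - \<psi> y) / norm (x - y) powr (N + 2 * s) \<partial>lborel)"
        using near[of x] r
        by (intro Bochner_Integration.integral_cong)
           (auto simp: N_def indicator_def diff_divide_distrib[symmetric])
      finally have "\<bar>frac_trunc s \<psi> x \<tau> - frac_trunc s \<phi> x \<tau>\<bar> \<le> B * (C2 * r powr (- (2 * s)))"
        using far[OF r, of "\<lambda>y. ?I \<tau> x y * (\<phi> y - \<psi> y)" B x] B B0 near
        by (auto simp: indicator_def)
      then have "\<bar>c * (frac_trunc s \<psi> x \<tau> - frac_trunc s \<phi> x \<tau>)\<bar> \<le> \<bar>c\<bar> * (B * (C2 * r powr (- (2 * s))))"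
        unfolding abs_mult by (rule mult_left_mono) simp
      then show ?thesis by (simp add: right_diff_distrib)
    qed
    have "\<bar>frac_lap s \<psi> x - frac_lap s \<phi> x\<bar> \<le> \<bar>c\<bar> * (B * (C2 * r powr (- (2 * s))))"
    \<comment> \<open>The bound for the truncations does not depend on \<tau>, so it survives the
      limit.\<close>
    proof (rule tendsto_upperbound)
      show "((\<lambda>\<tau>. \<bar>c * frac_trunc s \<psi> x \<tau> - c * frac_trunc s \<phi> x \<tau>\<bar>)
          \<longlongrightarrow> \<bar>frac_lap s \<psi> x - frac_lap s \<phi> x\<bar>) (at_right 0)"
        unfolding c_def by (intro tendsto_intros frac_lap_tendsto ex)
      show "\<forall>\<^sub>F \<tau> in at_right 0. \<bar>c * frac_trunc s \<psi> x \<tau> - c * frac_trunc s \<phi> x \<tau>\<bar>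
          \<le> \<bar>c\<bar> * (B * (C2 * r powr (- (2 * s))))"
        by (rule eventually_mono[OF eventually_at_right_less T])
    qed simp
    also have "\<dots> \<le> \<bar>c\<bar> * (B * ((C1 + C2) * r powr (- (2 * s))))"
      using B0 C1(1) by (intro mult_left_mono mult_right_mono) auto
    finally show "\<bar>frac_lap s \<psi> x - frac_lap s \<phi> x\<bar> \<le> K * B * r powr (- 2 * s)"
      by (simp add: K_def algebra_simps)
  qed
qed

section \<open>Approximation by compactly supported test functions\<close>

lemma bdist_nonneg: "0 \<le> bdist \<Omega> x"
  by (simp add: bdist_def infdist_nonneg)

lemma continuous_on_bdist: "continuous_on A (bdist \<Omega>)"
  unfolding bdist_def[abs_def] by (intro continuous_intros)

lemma borel_measurable_bdist [measurable]: "bdist \<Omega> \<in> borel_measurable borel"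
  by (intro borel_measurable_continuous_onI continuous_on_bdist)

lemma bdist_triangle: "bdist \<Omega> x \<le> bdist \<Omega> y + dist x y"
  unfolding bdist_def by (rule infdist_triangle)

lemma bdist_eq_0: "x \<notin> \<Omega> \<Longrightarrow> bdist \<Omega> x = 0"
  by (simp add: bdist_def)

text \<open>\<open>infdist\<close> to the empty set is 0 by convention; a nonempty complement makes
  \<delta> a genuine distance, positive inside \<Omega> and attained.\<close>

lemma Compl_bounded_nonempty: "bounded (\<Omega> :: (real^'n::finite) set) \<Longrightarrow> - \<Omega> \<noteq> {}"
  using not_bounded_UNIV[where 'a = "real^'n"] by (metis Compl_empty_eq double_compl)

lemma bdist_pos:
  assumes "open \<Omega>" "bounded \<Omega>" "x \<in> \<Omega>"
  shows "0 < bdist \<Omega> x"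
  unfolding bdist_def
  by (rule infdist_pos_not_in_closed) (use assms Compl_bounded_nonempty in auto)

text \<open>Compare \<phi>(x) with its value 0 at a nearest point of the closed complement.\<close>

lemma holder_le_bdist:
  fixes \<phi> :: "real^'n::finite \<Rightarrow> real"
  assumes \<Omega>: "open \<Omega>" "bounded \<Omega>"
    and H: "\<And>x y. \<bar>\<phi> x - \<phi> y\<bar> \<le> H * dist x y powr s"
    and z: "\<And>x. x \<notin> \<Omega> \<Longrightarrow> \<phi> x = 0"
  shows "\<bar>\<phi> x\<bar> \<le> H * bdist \<Omega> x powr s"
proof -
  obtain y where "y \<in> - \<Omega>" "infdist x (- \<Omega>) = dist x y"
    using infdist_attains_inf[of "- \<Omega>" x] \<Omega> Compl_bounded_nonempty[of \<Omega>] by (auto simp: closed_Compl)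
  then show ?thesis using H[of x y] z[of y] by (simp add: bdist_def)
qed

text \<open>Mollify the indicator of {\<delta> \<ge> 2e} at scale \<open>e\<close>. Since \<delta>
  is 1-Lipschitz, balls of radius \<open>e\<close> centred where \<delta> \<ge> 3e stay in this set,
  and those centred where \<delta> < e miss it.\<close>

lemma interior_cutoff_exists:
  fixes \<Omega> :: "(real^'n::finite) set"
  assumes e: "0 < e"
  obtains \<eta> where "\<And>x. 0 \<le> \<eta> x" "\<And>x. \<eta> x \<le> 1"
    "smooth_at_scale (96 * 4 ^ CARD('n)) e \<eta>"
    "\<And>x. 3 * e \<le> bdist \<Omega> x \<Longrightarrow> \<eta> x = 1" "\<And>x. bdist \<Omega> x < e \<Longrightarrow> \<eta> x = 0"
proof -
  let ?S = "{x. 2 * e \<le> bdist \<Omega> x}"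
  have S: "?S \<in> sets borel" by measurable
  obtain \<eta> where \<eta>: "\<And>x. 0 \<le> \<eta> x" "\<And>x. \<eta> x \<le> 1"
    "smooth_at_scale (96 * 4 ^ DIM(real^'n)) e \<eta>"
    "\<And>x. cball x e \<subseteq> ?S \<Longrightarrow> \<eta> x = 1" "\<And>x. cball x e \<inter> ?S = {} \<Longrightarrow> \<eta> x = 0"
    using smooth_cutoff_exists[OF e S] by metis
  have "\<eta> x = 1" if "3 * e \<le> bdist \<Omega> x" for x
  proof (rule \<eta>(4), rule subsetI)
    fix y assume "y \<in> cball x e"
    then show "y \<in> ?S" using bdist_triangle[of \<Omega> x y] that by simp
  qed
  moreover have "\<eta> x = 0" if "bdist \<Omega> x < e" for x
  proof (rule \<eta>(5), rule equals0I)
    fix y assume "y \<in> cball x e \<inter> ?S"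
    then show False using bdist_triangle[of \<Omega> y x] that by (simp add: dist_commute)
  qed
  ultimately show ?thesis using that[OF \<eta>(1,2)] \<eta>(3) by simp
qed

text \<open>The listed properties are what testing the local formulation and then dominated
  convergence require. Convergence of the Laplacians is stated pointwise; the majorant \<delta>^(-s)
  is the one that integrability of u / \<delta>^s can absorb.\<close>

lemma Xs_approx_compact_support:
  fixes \<Omega> :: "(real^'n::finite) set"
  assumes s: "0 < s" "s < 1" and \<Omega>: "open \<Omega>" "bounded \<Omega>" and \<phi>: "\<phi> \<in> Xs s \<Omega>"
  obtains \<psi> Q where "\<And>k. \<psi> k \<in> Xs s \<Omega> \<inter> Cc \<Omega>" "0 \<le> Q"
    "\<And>k x. \<bar>\<psi> k x\<bar> \<le> \<bar>\<phi> x\<bar>"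
    "\<And>x. x \<in> \<Omega> \<Longrightarrow> (\<lambda>k. \<psi> k x) \<longlonglongrightarrow> \<phi> x"
    "\<And>x. x \<in> \<Omega> \<Longrightarrow> (\<lambda>k. frac_lap s (\<psi> k) x) \<longlonglongrightarrow> frac_lap s \<phi> x"
    "\<And>k x. x \<in> \<Omega> \<Longrightarrow> \<bar>frac_lap s (\<psi> k) x\<bar> \<le> \<bar>frac_lap s \<phi> x\<bar> + Q * bdist \<Omega> x powr (- s)"
proof -
  obtain H where H: "\<And>x y. \<bar>\<phi> x - \<phi> y\<bar> \<le> H * dist x y powr s"
    using \<phi> by (auto simp: Xs_def holder_space_def)
  obtain Bd where Bd: "\<And>x. \<bar>\<phi> x\<bar> \<le> Bd"
    using \<phi> by (auto simp: Xs_def holder_space_def bounded_iff)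
  obtain M where M: "AE x in lebesgue. x \<in> \<Omega> \<longrightarrow> \<bar>frac_lap s \<phi> x\<bar> \<le> M"
    using \<phi> by (auto simp: Xs_def)
  have z: "\<phi> x = 0" if "x \<notin> \<Omega>" for x using \<phi> that by (auto simp: Xs_def)
  have ex: "frac_lap_exists s \<phi> x" if "x \<in> \<Omega>" for x using \<phi> that by (auto simp: Xs_def)
  have H0: "0 \<le> H" by (rule holder_const_nonneg[OF H])
  have Bd0: "0 \<le> Bd" using Bd[of 0] by linarith
  have c\<phi>: "continuous_on UNIV \<phi>" by (rule holder_continuous_on[OF H s(1)])
  then have m\<phi>[measurable]: "\<phi> \<in> borel_measurable borel" by (rule borel_measurable_continuous_onI)
  let ?d = "bdist \<Omega>"
  have Hd: "\<bar>\<phi> x\<bar> \<le> H * ?d x powr s" for x by (rule holder_le_bdist[OF \<Omega> H z])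
  define A where "A = (96 * 4 ^ CARD('n) :: real)"
  have A0: "0 \<le> A" by (simp add: A_def)
  obtain K where K0: "0 \<le> K" and Kprod:
    "\<And>e A H \<eta> \<phi> (x :: real^'n::finite).
       \<lbrakk>0 < e; 0 \<le> A; smooth_at_scale A e \<eta>; \<phi> \<in> borel_measurable borel;
        \<And>x y. \<bar>\<phi> x - \<phi> y\<bar> \<le> H * dist x y powr s; frac_lap_exists s \<phi> x\<rbrakk> \<Longrightarrow>
       frac_lap_exists s (\<lambda>y. \<phi> y * \<eta> y) x \<and>
       \<bar>frac_lap s (\<lambda>y. \<phi> y * \<eta> y) x - \<eta> x * frac_lap s \<phi> x\<bar>
         \<le> K * A * (\<bar>\<phi> x\<bar> * e powr (- 2 * s) + H * e powr (- s))"
    and Kfar: "\<And>r B \<phi> \<psi> (x :: real^'n::finite).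
       \<lbrakk>0 < r; \<phi> \<in> borel_measurable borel; \<psi> \<in> borel_measurable borel;
        \<And>y. \<bar>\<phi> y - \<psi> y\<bar> \<le> B; \<And>y. dist x y < r \<Longrightarrow> \<psi> y = \<phi> y;
        frac_lap_exists s \<phi> x; frac_lap_exists s \<psi> x\<rbrakk> \<Longrightarrow>
       \<bar>frac_lap s \<psi> x - frac_lap s \<phi> x\<bar> \<le> K * B * r powr (- 2 * s)"
    using frac_lap_product[OF s] by blast
  define e where "e k = inverse (real (Suc k))" for k
  have e: "0 < e k" for k by (simp add: e_def)
  have e0: "e \<longlonglongrightarrow> 0" unfolding e_def[abs_def] by (rule LIMSEQ_inverse_real_of_nat)
  have "\<forall>k. \<exists>\<eta>. (\<forall>x. 0 \<le> \<eta> x) \<and> (\<forall>x. \<eta> x \<le> 1) \<and> smooth_at_scale A (e k) \<eta> \<and>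
      (\<forall>x. 3 * e k \<le> ?d x \<longrightarrow> \<eta> x = 1) \<and> (\<forall>x. ?d x < e k \<longrightarrow> \<eta> x = 0)"
    unfolding A_def using interior_cutoff_exists[OF e, where \<Omega> = \<Omega>] by metis
  then obtain \<eta> where "\<forall>k. (\<forall>x. 0 \<le> \<eta> k x) \<and> (\<forall>x. \<eta> k x \<le> 1) \<and> smooth_at_scale A (e k) (\<eta> k) \<and>
      (\<forall>x. 3 * e k \<le> ?d x \<longrightarrow> \<eta> k x = 1) \<and> (\<forall>x. ?d x < e k \<longrightarrow> \<eta> k x = 0)"
    by metis
  then have \<eta>: "0 \<le> \<eta> k x" "\<eta> k x \<le> 1" "smooth_at_scale A (e k) (\<eta> k)"
      "3 * e k \<le> ?d x \<Longrightarrow> \<eta> k x = 1" "?d x < e k \<Longrightarrow> \<eta> k x = 0" for k x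
    by auto
  define \<psi> where "\<psi> k = (\<lambda>x. \<phi> x * \<eta> k x)" for k
  have c\<eta>: "continuous_on UNIV (\<eta> k)" for k by (rule smooth_at_scale_continuous[OF \<eta>(3) e A0])
  have c\<psi>: "continuous_on UNIV (\<psi> k)" for k
    unfolding \<psi>_def by (intro continuous_on_mult c\<phi> c\<eta>)
  have m\<psi>[measurable]: "\<psi> k \<in> borel_measurable borel" for k
    using c\<psi> by (rule borel_measurable_continuous_onI)
  have le: "\<bar>\<psi> k x\<bar> \<le> \<bar>\<phi> x\<bar>" for k x
    using \<eta>(1,2)[of k x] by (simp add: \<psi>_def abs_mult mult_left_le)
  have ex\<psi>: "frac_lap_exists s (\<psi> k) x"
    and prod: "\<bar>frac_lap s (\<psi> k) x - \<eta> k x * frac_lap s \<phi> x\<bar>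
         \<le> K * A * (\<bar>\<phi> x\<bar> * e k powr (- 2 * s) + H * e k powr (- s))" if "x \<in> \<Omega>" for k x
    using Kprod[OF e A0 \<eta>(3) m\<phi> H ex[OF that], of k] by (auto simp: \<psi>_def)
  have \<eta>L: "\<bar>\<eta> k x * frac_lap s \<phi> x\<bar> \<le> \<bar>frac_lap s \<phi> x\<bar>" for k x
    using \<eta>(1,2)[of k x] by (simp add: abs_mult mult_left_le_one_le)
  have dpos: "0 < ?d x" if "x \<in> \<Omega>" for x by (rule bdist_pos[OF \<Omega> that])
  \<comment> \<open>Locality with r = \<delta>(x)/2: since 3 \<open>e k\<close> \<le> \<delta>(x)/2,
    the cutoff is 1 throughout that ball. Elsewhere \<phi> - \<psi> is nonzero only where \<delta> <
    3 \<open>e k\<close>, so it is at most H (3 \<open>e k\<close>)^s.\<close>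
  have far: "\<bar>frac_lap s (\<psi> k) x - frac_lap s \<phi> x\<bar> \<le> K * (H * (3 * e k) powr s) * (?d x / 2) powr (- 2 * s)"
    if x: "x \<in> \<Omega>" and d: "6 * e k \<le> ?d x" for k x
  proof (rule Kfar)
    show "0 < ?d x / 2" using dpos[OF x] by simp
    show "\<bar>\<phi> y - \<psi> k y\<bar> \<le> H * (3 * e k) powr s" for y
    proof (cases "3 * e k \<le> ?d y")
      case True
      then show ?thesis using H0 by (simp add: \<psi>_def \<eta>)
    next
      case False
      have "\<bar>\<phi> y - \<psi> k y\<bar> = \<bar>\<phi> y\<bar> * (1 - \<eta> k y)"
      proof -
        have "\<phi> y - \<psi> k y = \<phi> y * (1 - \<eta> k y)" by (simp add: \<psi>_def algebra_simps)
        then show ?thesis using \<eta>(2)[of k y] by (simp add: abs_mult)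
      qed
      also have "\<dots> \<le> \<bar>\<phi> y\<bar> * 1" using \<eta>(1)[of k y] by (intro mult_left_mono) auto
      also have "\<dots> \<le> H * ?d y powr s" using Hd by simp
      also have "\<dots> \<le> H * (3 * e k) powr s"
        using False s H0 by (intro mult_left_mono powr_mono2) (auto simp: bdist_nonneg)
      finally show ?thesis .
    qed
    show "\<psi> k y = \<phi> y" if "dist x y < ?d x / 2" for y
    proof -
      have "3 * e k \<le> ?d y" using bdist_triangle[of \<Omega> x y] that d by linarith
      then show ?thesis by (simp add: \<psi>_def \<eta>)
    qed
  qed (use ex[OF x] ex\<psi>[OF x] in auto)
  \<comment> \<open>The sum of the constants of two regimes, with D = \<delta>(x). If 6
    \<open>e k\<close> \<le> D, then 3 \<open>e k\<close> \<le> D/2 and \<open>far\<close> gives K H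
    (D/2)^(-s), hence the factor 2^s. Otherwise \<open>e k\<close> > D/6, so the negative powers of
    \<open>e k\<close> in \<open>prod\<close> cost 6^(2s) and 6^s, while |\<phi>(x)| \<le> H
    D^s.\<close>
  define Q where "Q = K * H * 2 powr s + K * A * (H * 6 powr (2 * s) + H * 6 powr s)"
  have Q0: "0 \<le> Q" using K0 A0 H0 by (simp add: Q_def)
  have dom: "\<bar>frac_lap s (\<psi> k) x\<bar> \<le> \<bar>frac_lap s \<phi> x\<bar> + Q * ?d x powr (- s)" if x: "x \<in> \<Omega>" for k x
  proof (cases "6 * e k \<le> ?d x")
    case True
    define D where "D = ?d x"
    have D: "0 < D" using dpos[OF x] by (simp add: D_def)
    have "(3 * e k) powr s \<le> (D / 2) powr s"
      using True s e[of k] by (intro powr_mono2) (auto simp: D_def)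
    then have "K * (H * (3 * e k) powr s) * (D / 2) powr (- 2 * s) \<le> K * (H * (D / 2) powr s) * (D / 2) powr (- 2 * s)"
      using K0 H0 by (intro mult_right_mono mult_left_mono) auto
    also have "\<dots> = K * H * ((D / 2) powr s * (D / 2) powr (- 2 * s))" by simp
    also have "(D / 2) powr s * (D / 2) powr (- 2 * s) = 2 powr s * D powr (- s)"
    proof -
      have "(D / 2) powr s * (D / 2) powr (- 2 * s) = (D / 2) powr (- s)"
        unfolding powr_add[symmetric] by simp
      then show ?thesis using D by (simp add: powr_divide powr_minus field_simps)
    qed
    finally have "\<bar>frac_lap s (\<psi> k) x - frac_lap s \<phi> x\<bar> \<le> (K * H * 2 powr s) * D powr (- s)"
      using far[OF x True] by (simp add: D_def algebra_simps)
    also have "\<dots> \<le> Q * D powr (- s)"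
      unfolding Q_def using K0 A0 H0 by (intro mult_right_mono) auto
    finally show ?thesis by (simp add: D_def)
  next
    case False
    define D where "D = ?d x"
    have D: "0 < D" using dpos[OF x] by (simp add: D_def)
    have De: "D / 6 \<le> e k" using False by (simp add: D_def)
    have 1: "\<bar>\<phi> x\<bar> * e k powr (- 2 * s) \<le> (H * D powr s) * (D / 6) powr (- 2 * s)"
      using Hd[of x] De D s H0 by (intro mult_mono powr_mono2') (auto simp: D_def)
    have 2: "H * e k powr (- s) \<le> H * (D / 6) powr (- s)"
      using De D s H0 by (intro mult_left_mono powr_mono2') auto
    have 3: "D powr s * (D / 6) powr (- 2 * s) = 6 powr (2 * s) * D powr (- s)"
    proof -
      have "(D / 6) powr (- 2 * s) = 6 powr (2 * s) * D powr (- 2 * s)"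
        using D by (simp add: powr_divide powr_minus field_simps)
      moreover have "D powr s * D powr (- 2 * s) = D powr (- s)"
        using D by (simp add: powr_add[symmetric])
      ultimately show ?thesis by (simp add: mult_ac)
    qed
    have 4: "(D / 6) powr (- s) = 6 powr s * D powr (- s)"
      using D by (simp add: powr_divide powr_minus field_simps)
    have "\<bar>\<phi> x\<bar> * e k powr (- 2 * s) + H * e k powr (- s)
        \<le> H * (D powr s * (D / 6) powr (- 2 * s)) + H * (D / 6) powr (- s)"
      using 1 2 by (simp add: mult.assoc)
    also have "\<dots> = (H * 6 powr (2 * s) + H * 6 powr s) * D powr (- s)"
      unfolding 3 4 by (simp add: algebra_simps)
    finally have "K * A * (\<bar>\<phi> x\<bar> * e k powr (- 2 * s) + H * e k powr (- s))
        \<le> K * A * ((H * 6 powr (2 * s) + H * 6 powr s) * D powr (- s))"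
      using K0 A0 by (intro mult_left_mono) auto
    then have "\<bar>frac_lap s (\<psi> k) x - \<eta> k x * frac_lap s \<phi> x\<bar>
        \<le> (K * A * (H * 6 powr (2 * s) + H * 6 powr s)) * D powr (- s)"
      using prod[OF x, of k] by (simp add: mult.assoc)
    also have "\<dots> \<le> Q * D powr (- s)"
      unfolding Q_def using K0 A0 H0 by (intro mult_right_mono) auto
    finally show ?thesis using \<eta>L[of k x] by (simp add: D_def)
  qed
  have lim: "(\<lambda>k. frac_lap s (\<psi> k) x) \<longlonglongrightarrow> frac_lap s \<phi> x" and lim\<psi>: "(\<lambda>k. \<psi> k x) \<longlonglongrightarrow> \<phi> x"
    if x: "x \<in> \<Omega>" for x
  proof -
    \<comment> \<open>A fixed point of \<Omega> is eventually in the far regime, where \<psi> k x =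
      \<phi> x and the Laplacians differ by O((\<open>e k\<close>)^s).\<close>
    have ev: "\<forall>\<^sub>F k in sequentially. 6 * e k \<le> ?d x"
    proof -
      have "\<forall>\<^sub>F k in sequentially. e k < ?d x / 6"
        using e0 dpos[OF x] by (intro order_tendstoD(2)) auto
      then show ?thesis by eventually_elim simp
    qed
    have "(\<lambda>k. K * (H * (3 * e k) powr s) * (?d x / 2) powr (- 2 * s)) \<longlonglongrightarrow>
        K * (H * (3 * 0) powr s) * (?d x / 2) powr (- 2 * s)"
      by (intro tendsto_intros tendsto_powr' e0) (use s e in \<open>auto simp: less_imp_le\<close>)
    then have "(\<lambda>k. K * (H * (3 * e k) powr s) * (?d x / 2) powr (- 2 * s)) \<longlonglongrightarrow> 0" by simp
    then have "(\<lambda>k. frac_lap s (\<psi> k) x - frac_lap s \<phi> x) \<longlonglongrightarrow> 0"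
      by (rule Lim_null_comparison[rotated])
         (use ev in \<open>eventually_elim, use far[OF x] in auto\<close>)
    then show "(\<lambda>k. frac_lap s (\<psi> k) x) \<longlonglongrightarrow> frac_lap s \<phi> x" by (rule LIM_zero_cancel)
    show "(\<lambda>k. \<psi> k x) \<longlonglongrightarrow> \<phi> x"
    proof (rule tendsto_eventually, use ev in eventually_elim)
      case (elim k)
      then show ?case using e[of k] by (simp add: \<psi>_def \<eta>)
    qed
  qed
  \<comment> \<open>The cutoff is Hoelder because min 1 t \<le> t^s for t \<ge> 0 and 0 < s < 1. The
    Hoelder constant grows with \<open>k\<close>, which is harmless: membership is needed for each
    \<open>k\<close> separately.\<close>
  have holder: "\<psi> k \<in> holder_space s" for k
  proof -
    have "\<bar>\<psi> k x - \<psi> k y\<bar> \<le> (H + Bd * A * (e k) powr (- s)) * dist x y powr s" for x y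
    proof -
      have "\<bar>\<eta> k (y + (x - y)) - \<eta> k y\<bar> \<le> A * min 1 (norm (x - y) / e k)"
        using \<eta>(3)[of k] unfolding smooth_at_scale_def by blast
      also have "\<dots> \<le> A * (dist x y / e k) powr s"
      proof (intro mult_left_mono A0)
        define t where "t = dist x y / e k"
        have "0 \<le> t" using e[of k] by (simp add: t_def)
        then have "min 1 t \<le> t powr s"
        proof (cases "1 \<le> t")
          case True
          then show ?thesis using s by (simp add: ge_one_powr_ge_zero)
        next
          case False
          then have "t powr 1 \<le> t powr s" using \<open>0 \<le> t\<close> s by (intro powr_mono') auto
          then show ?thesis using \<open>0 \<le> t\<close> False by simp
        qed
        then show "min 1 (norm (x - y) / e k) \<le> (dist x y / e k) powr s" by (simp add: t_def dist_norm)
      qed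
      finally have 1: "\<bar>\<eta> k x - \<eta> k y\<bar> \<le> A * (dist x y / e k) powr s" by simp
      have "\<psi> k x - \<psi> k y = (\<phi> x - \<phi> y) * \<eta> k x + \<phi> y * (\<eta> k x - \<eta> k y)"
        by (simp add: \<psi>_def algebra_simps)
      then have "\<bar>\<psi> k x - \<psi> k y\<bar> \<le> \<bar>\<phi> x - \<phi> y\<bar> * \<eta> k x + \<bar>\<phi> y\<bar> * \<bar>\<eta> k x - \<eta> k y\<bar>"
        using abs_triangle_ineq[of "(\<phi> x - \<phi> y) * \<eta> k x" "\<phi> y * (\<eta> k x - \<eta> k y)"] \<eta>(1)[of k x]
        by (simp add: abs_mult)
      also have "\<dots> \<le> (H * dist x y powr s) * 1 + Bd * (A * (dist x y / e k) powr s)"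
        using H0 Bd0 \<eta>(1,2) by (intro add_mono mult_mono H Bd 1) auto
      also have "\<dots> = (H + Bd * A * (e k) powr (- s)) * dist x y powr s"
        using e[of k] by (simp add: powr_divide powr_minus field_simps)
      finally show ?thesis .
    qed
    moreover have "bounded (range (\<psi> k))"
      using order_trans[OF le Bd] by (auto simp: bounded_iff)
    ultimately show ?thesis by (auto simp: holder_space_def)
  qed
  \<comment> \<open>The commutator bound together with boundedness of \<phi> makes the Laplacian of
    \<psi> k essentially bounded, again with a bound depending on \<open>k\<close>.\<close>
  have X: "\<psi> k \<in> Xs s \<Omega>" for k
  proof -
    have "AE x in lebesgue. x \<in> \<Omega> \<longrightarrow> \<bar>frac_lap s (\<psi> k) x\<bar> \<le> M + K * A * (Bd * e k powr (- 2 * s) + H * e k powr (- s))"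
      using M
    proof eventually_elim
      case (elim x)
      show ?case
      proof
        assume x: "x \<in> \<Omega>"
        have "K * A * (\<bar>\<phi> x\<bar> * e k powr (- 2 * s) + H * e k powr (- s))
            \<le> K * A * (Bd * e k powr (- 2 * s) + H * e k powr (- s))"
          using K0 A0 Bd[of x] by (intro mult_left_mono add_mono mult_right_mono) auto
        then show "\<bar>frac_lap s (\<psi> k) x\<bar> \<le> M + K * A * (Bd * e k powr (- 2 * s) + H * e k powr (- s))"
          using elim x prod[OF x, of k] \<eta>L[of k x] by linarith
      qed
    qed
    moreover have "set_borel_measurable lebesgue \<Omega> (frac_lap s (\<psi> k))"
      using \<Omega>(1) by (intro frac_lap_measurable ex\<psi>) auto
    moreover have "\<psi> k x = 0" if "x \<notin> \<Omega>" for x using z[OF that] by (simp add: \<psi>_def)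
    ultimately show ?thesis using holder ex\<psi> by (auto simp: Xs_def)
  qed
  have C: "\<psi> k \<in> Cc \<Omega>" for k
  proof -
    \<comment> \<open>\<psi> k vanishes off {\<delta> \<ge> \<open>e k\<close>}, which lies in
      \<Omega> because \<delta> = 0 outside \<Omega> and \<open>e k\<close> > 0.\<close>
    let ?C = "{x. e k \<le> ?d x}"
    have sub: "?C \<subseteq> \<Omega>" using bdist_eq_0[of _ \<Omega>] e[of k] by force
    have "closed ?C" by (intro closed_Collect_le continuous_intros continuous_on_bdist)
    moreover have "bounded ?C" using \<Omega>(2) sub by (rule bounded_subset)
    ultimately have "compact ?C" by (simp add: compact_eq_bounded_closed)
    moreover have "\<psi> k x = 0" if "x \<notin> ?C" for x using that by (simp add: \<psi>_def \<eta>)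
    ultimately show ?thesis using sub c\<psi> unfolding Cc_def by blast
  qed
  show ?thesis by (rule that[of \<psi> Q]) (use X C Q0 le lim\<psi> lim dom in auto)
qed

section \<open>Passage to the limit in the weak formulation\<close>

theorem theorem4p8:
  fixes s :: real and \<Omega> :: "(real^'n::finite) set"
    and V f u :: "real^'n \<Rightarrow> real"
  assumes "CARD('n) \<ge> 2"
    and "0 < s" "s < 1"
    and "C2_bounded_domain \<Omega>"
    and "\<forall>x\<in>\<Omega>. 0 \<le> V x" "L1_loc \<Omega> V"
    and "L1 \<Omega> (\<lambda>x. f x * bdist \<Omega> x powr s)"
    and "very_weak_local_sol s \<Omega> V f u"
    and "L1 \<Omega> (\<lambda>x. V x * u x * bdist \<Omega> x powr s)"
    and "L1 \<Omega> (\<lambda>x. u x / bdist \<Omega> x powr s)"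
  shows "very_weak_sol s \<Omega> V f u"
proof -
  have \<Omega>: "open \<Omega>" "bounded \<Omega>" using assms(4) by (auto simp: C2_bounded_domain_def)
  have loc: "L1 \<Omega> u" "AE x in lebesgue. x \<notin> \<Omega> \<longrightarrow> u x = 0"
    "\<And>\<phi>. \<phi> \<in> Xs s \<Omega> \<inter> Cc \<Omega> \<Longrightarrow>
        (LINT x : \<Omega> | lebesgue. u x * (frac_lap s \<phi> x + V x * \<phi> x)) = (LINT x : \<Omega> | lebesgue. f x * \<phi> x)"
    using assms(8) by (auto simp: very_weak_local_sol_def)
  let ?d = "\<lambda>x. bdist \<Omega> x powr s"
  let ?i = "\<lambda>x. indicator \<Omega> x :: real"
  have dpos: "0 < ?d x" if "x \<in> \<Omega>" for x using bdist_pos[OF \<Omega> that] by simp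
  \<comment> \<open>Zero extensions of the four integrable functions: all integrals are then over
    the whole space, and these functions supply both measurability and majorants.\<close>
  define U where "U x = ?i x * u x" for x
  define U' where "U' x = ?i x * (u x / ?d x)" for x
  define W where "W x = ?i x * (V x * u x * ?d x)" for x
  define F where "F x = ?i x * (f x * ?d x)" for x
  have int: "integrable lebesgue U" "integrable lebesgue U'" "integrable lebesgue W" "integrable lebesgue F"
    using loc(1) assms(7,9,10)
    by (simp_all add: L1_def set_integrable_def U_def[abs_def] U'_def[abs_def] W_def[abs_def] F_def[abs_def])
  note [measurable] = int[THEN borel_measurable_integrable]
  have "(LINT x : \<Omega> | lebesgue. u x * frac_lap s \<phi> x) + (LINT x : \<Omega> | lebesgue. V x * u x * \<phi> x)
      = (LINT x : \<Omega> | lebesgue. f x * \<phi> x)" if \<phi>: "\<phi> \<in> Xs s \<Omega>" for \<phi>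
  proof -
    obtain H where H: "\<And>x y. \<bar>\<phi> x - \<phi> y\<bar> \<le> H * dist x y powr s"
      using \<phi> by (auto simp: Xs_def holder_space_def)
    obtain M where M: "AE x in lebesgue. x \<in> \<Omega> \<longrightarrow> \<bar>frac_lap s \<phi> x\<bar> \<le> M"
      using \<phi> by (auto simp: Xs_def)
    have Hd: "\<bar>\<phi> x\<bar> \<le> H * ?d x" for x
      by (rule holder_le_bdist[OF \<Omega> H]) (use \<phi> in \<open>auto simp: Xs_def\<close>)
    have mX: "g \<in> borel_measurable lebesgue" "(\<lambda>x. ?i x * frac_lap s g x) \<in> borel_measurable lebesgue"
      if g: "g \<in> Xs s \<Omega>" for g
    proof -
      obtain C where C: "\<And>x y. \<bar>g x - g y\<bar> \<le> C * dist x y powr s"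
        using g by (auto simp: Xs_def holder_space_def)
      have "g \<in> borel_measurable borel"
        by (intro borel_measurable_continuous_onI holder_continuous_on[OF C assms(2)])
      then show "g \<in> borel_measurable lebesgue" by (simp add: measurable_completion)
      show "(\<lambda>x. ?i x * frac_lap s g x) \<in> borel_measurable lebesgue"
        using g by (simp add: Xs_def set_borel_measurable_def)
    qed
    have [measurable]: "?d \<in> borel_measurable lebesgue"
      by (intro measurable_completion) simp
    obtain \<psi> Q where \<psi>: "\<And>k. \<psi> k \<in> Xs s \<Omega> \<inter> Cc \<Omega>" "0 \<le> Q"
      "\<And>k x. \<bar>\<psi> k x\<bar> \<le> \<bar>\<phi> x\<bar>"
      "\<And>x. x \<in> \<Omega> \<Longrightarrow> (\<lambda>k. \<psi> k x) \<longlonglongrightarrow> \<phi> x"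
      "\<And>x. x \<in> \<Omega> \<Longrightarrow> (\<lambda>k. frac_lap s (\<psi> k) x) \<longlonglongrightarrow> frac_lap s \<phi> x"
      "\<And>k x. x \<in> \<Omega> \<Longrightarrow> \<bar>frac_lap s (\<psi> k) x\<bar> \<le> \<bar>frac_lap s \<phi> x\<bar> + Q * bdist \<Omega> x powr (- s)"
      using Xs_approx_compact_support[OF assms(2,3) \<Omega> \<phi>] by metis
    \<comment> \<open>Factoring the integrands through \<open>U\<close>, \<open>W\<close> and
      \<open>F\<close> gives their measurability; since \<delta>^s > 0 on \<Omega> and |\<phi>|
      \<le> H \<delta>^s, the quotient g / \<delta>^s is at most \<open>H\<close> for every |g|
      \<le> |\<phi>|.\<close>
    have a: "?i x * (u x * frac_lap s g x) = U x * (?i x * frac_lap s g x)" for g x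
      by (simp add: U_def indicator_def)
    have b: "?i x * (V x * u x * g x) = W x * (g x / ?d x)" for g :: "real^'n \<Rightarrow> real" and x
      using dpos[of x] by (auto simp: W_def indicator_def)
    have c: "?i x * (f x * g x) = F x * (g x / ?d x)" for g :: "real^'n \<Rightarrow> real" and x
      using dpos[of x] by (auto simp: F_def indicator_def)
    have mab: "(\<lambda>x. ?i x * (u x * frac_lap s g x)) \<in> borel_measurable lebesgue"
      "(\<lambda>x. ?i x * (V x * u x * g x)) \<in> borel_measurable lebesgue"
      "(\<lambda>x. ?i x * (f x * g x)) \<in> borel_measurable lebesgue" if "g \<in> Xs s \<Omega>" for g
    proof -
      note [measurable] = mX[OF that]
      show "(\<lambda>x. ?i x * (u x * frac_lap s g x)) \<in> borel_measurable lebesgue"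
        "(\<lambda>x. ?i x * (V x * u x * g x)) \<in> borel_measurable lebesgue"
        "(\<lambda>x. ?i x * (f x * g x)) \<in> borel_measurable lebesgue"
        unfolding a b c by measurable
    qed
    have q: "\<bar>g x / ?d x\<bar> \<le> H" if "\<bar>g x\<bar> \<le> \<bar>\<phi> x\<bar>" "x \<in> \<Omega>" for g :: "real^'n \<Rightarrow> real" and x
      using order_trans[OF that(1) Hd] dpos[OF that(2)] by (simp add: field_simps)
    have boundV: "\<bar>?i x * (V x * u x * g x)\<bar> \<le> H * \<bar>W x\<bar>" and boundf: "\<bar>?i x * (f x * g x)\<bar> \<le> H * \<bar>F x\<bar>"
      if "\<bar>g x\<bar> \<le> \<bar>\<phi> x\<bar>" for g :: "real^'n \<Rightarrow> real" and x
    proof -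
      have "\<bar>?i x * (V x * u x * g x)\<bar> \<le> H * \<bar>W x\<bar> \<and> \<bar>?i x * (f x * g x)\<bar> \<le> H * \<bar>F x\<bar>"
      proof (cases "x \<in> \<Omega>")
        case True
        show ?thesis unfolding b c abs_mult[of _ "g x / ?d x"] mult.commute[of H]
          using q[of g x, OF that True] by (intro conjI mult_left_mono) auto
      qed (simp add: W_def F_def)
      then show "\<bar>?i x * (V x * u x * g x)\<bar> \<le> H * \<bar>W x\<bar>" "\<bar>?i x * (f x * g x)\<bar> \<le> H * \<bar>F x\<bar>" by auto
    qed
    \<comment> \<open>Quantifying over \<open>g\<close> inside the almost-everywhere statement
      leaves one exceptional set, that of the essential bound \<open>M\<close>, for \<phi> and all
      \<psi> k at once.\<close>
    have boundL: "AE x in lebesgue. \<forall>g. (x \<in> \<Omega> \<longrightarrow> \<bar>frac_lap s g x\<bar> \<le> \<bar>frac_lap s \<phi> x\<bar> + Q * bdist \<Omega> x powr (- s))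
        \<longrightarrow> \<bar>?i x * (u x * frac_lap s g x)\<bar> \<le> \<bar>M\<bar> * \<bar>U x\<bar> + Q * \<bar>U' x\<bar>"
      using M
    proof (eventually_elim, intro allI impI)
      fix x g
      assume M: "x \<in> \<Omega> \<longrightarrow> \<bar>frac_lap s \<phi> x\<bar> \<le> M"
        and L: "x \<in> \<Omega> \<longrightarrow> \<bar>frac_lap s g x\<bar> \<le> \<bar>frac_lap s \<phi> x\<bar> + Q * bdist \<Omega> x powr (- s)"
      show "\<bar>?i x * (u x * frac_lap s g x)\<bar> \<le> \<bar>M\<bar> * \<bar>U x\<bar> + Q * \<bar>U' x\<bar>"
      proof (cases "x \<in> \<Omega>")
        case True
        then have "\<bar>frac_lap s g x\<bar> \<le> \<bar>M\<bar> + Q * bdist \<Omega> x powr (- s)" using M L by linarith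
        then have "\<bar>u x\<bar> * \<bar>frac_lap s g x\<bar> \<le> \<bar>u x\<bar> * (\<bar>M\<bar> + Q * bdist \<Omega> x powr (- s))"
          by (rule mult_left_mono) simp
        then show ?thesis using True
          by (simp add: U_def U'_def abs_mult powr_minus_divide algebra_simps)
      qed (simp add: U_def U'_def \<psi>(2))
    qed
    have intL: "integrable lebesgue (\<lambda>x. \<bar>M\<bar> * \<bar>U x\<bar> + Q * \<bar>U' x\<bar>)"
      and intW: "integrable lebesgue (\<lambda>x. H * \<bar>W x\<bar>)" and intF: "integrable lebesgue (\<lambda>x. H * \<bar>F x\<bar>)"
      using int by auto
    \<comment> \<open>For g = \<phi> the premise of \<open>boundL\<close> holds because Q \<ge> 0.
      Integrability of the two limit terms allows their sum to be split at the end.\<close>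
    have i1: "integrable lebesgue (\<lambda>x. ?i x * (u x * frac_lap s \<phi> x))"
      by (rule Bochner_Integration.integrable_bound[OF intL mab(1)[OF \<phi>]])
         (use boundL in eventually_elim, use \<psi>(2) in force)
    have i2: "integrable lebesgue (\<lambda>x. ?i x * (V x * u x * \<phi> x))"
      by (rule Bochner_Integration.integrable_bound[OF intW mab(2)[OF \<phi>]])
         (use boundV[of \<phi>] in \<open>auto intro: order_trans[OF _ abs_ge_self]\<close>)
    have lim1: "(\<lambda>k. \<integral>x. ?i x * (u x * frac_lap s (\<psi> k) x) + ?i x * (V x * u x * \<psi> k x) \<partial>lebesgue)
        \<longlonglongrightarrow> (\<integral>x. ?i x * (u x * frac_lap s \<phi> x) + ?i x * (V x * u x * \<phi> x) \<partial>lebesgue)"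
    proof (rule integral_dominated_convergence)
      \<comment> \<open>\<open>U\<close> absorbs the bounded part of the Laplacians,
        \<open>U'\<close> the part of order \<delta>^(-s), and \<open>W\<close> the potential
        term.\<close>
      show "integrable lebesgue (\<lambda>x. (\<bar>M\<bar> * \<bar>U x\<bar> + Q * \<bar>U' x\<bar>) + H * \<bar>W x\<bar>)"
        using intL intW by (rule Bochner_Integration.integrable_add)
      show "AE x in lebesgue. (\<lambda>k. ?i x * (u x * frac_lap s (\<psi> k) x) + ?i x * (V x * u x * \<psi> k x))
          \<longlonglongrightarrow> ?i x * (u x * frac_lap s \<phi> x) + ?i x * (V x * u x * \<phi> x)"
      proof (rule AE_I2)
        fix x
        show "(\<lambda>k. ?i x * (u x * frac_lap s (\<psi> k) x) + ?i x * (V x * u x * \<psi> k x))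
          \<longlonglongrightarrow> ?i x * (u x * frac_lap s \<phi> x) + ?i x * (V x * u x * \<phi> x)"
          by (cases "x \<in> \<Omega>") (auto intro!: tendsto_intros \<psi>)
      qed
      show "AE x in lebesgue. norm (?i x * (u x * frac_lap s (\<psi> k) x) + ?i x * (V x * u x * \<psi> k x))
          \<le> (\<bar>M\<bar> * \<bar>U x\<bar> + Q * \<bar>U' x\<bar>) + H * \<bar>W x\<bar>" for k
        using boundL
      proof eventually_elim
        case (elim x)
        have "\<bar>?i x * (u x * frac_lap s (\<psi> k) x)\<bar> \<le> \<bar>M\<bar> * \<bar>U x\<bar> + Q * \<bar>U' x\<bar>"
          using elim \<psi>(6) by blast
        then show ?case using boundV[of "\<psi> k" x, OF \<psi>(3)]
          by (auto intro: order_trans[OF abs_triangle_ineq] add_mono)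
      qed
    qed (use mab \<phi> \<psi>(1) in \<open>auto intro!: borel_measurable_add\<close>)
    have lim2: "(\<lambda>k. \<integral>x. ?i x * (f x * \<psi> k x) \<partial>lebesgue) \<longlonglongrightarrow> (\<integral>x. ?i x * (f x * \<phi> x) \<partial>lebesgue)"
    proof (rule integral_dominated_convergence[OF _ _ intF])
      show "AE x in lebesgue. (\<lambda>k. ?i x * (f x * \<psi> k x)) \<longlonglongrightarrow> ?i x * (f x * \<phi> x)"
      proof (rule AE_I2)
        fix x
        show "(\<lambda>k. ?i x * (f x * \<psi> k x)) \<longlonglongrightarrow> ?i x * (f x * \<phi> x)"
          by (cases "x \<in> \<Omega>") (auto intro!: tendsto_intros \<psi>)
      qed
      show "AE x in lebesgue. norm (?i x * (f x * \<psi> k x)) \<le> H * \<bar>F x\<bar>" for k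
        using boundf[of "\<psi> k", OF \<psi>(3)] by simp
    qed (use mab \<phi> \<psi>(1) in auto)
    \<comment> \<open>The local formulation tested with the admissible functions \<psi> k; both
      sides converge, and uniqueness of limits gives the identity for \<phi>.\<close>
    have "(\<integral>x. ?i x * (u x * frac_lap s (\<psi> k) x) + ?i x * (V x * u x * \<psi> k x) \<partial>lebesgue)
        = (\<integral>x. ?i x * (f x * \<psi> k x) \<partial>lebesgue)" for k
      using loc(3)[OF \<psi>(1), of k] by (simp add: set_lebesgue_integral_def algebra_simps)
    then have "(\<integral>x. ?i x * (u x * frac_lap s \<phi> x) + ?i x * (V x * u x * \<phi> x) \<partial>lebesgue)
        = (\<integral>x. ?i x * (f x * \<phi> x) \<partial>lebesgue)"
      using LIMSEQ_unique[OF lim1] lim2 by simp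
    then show ?thesis
      unfolding Bochner_Integration.integral_add[OF i1 i2] by (simp add: set_lebesgue_integral_def)
  qed
  then show ?thesis using loc assms(9) by (simp add: very_weak_sol_def)
qed

end
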